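(* For integers $i,j\ge0$ let $N_{i,j}(n)$ be the number of nodes with in-degree $i$ and out-degree $j$ in $G(n)$. Then $$\frac{N_{i,j}(n)}{n}\to\mathbf P\big((\mathcal I,\mathcal O)=(i,j)\big)\quad\text{in probability as }n\to\infty,$$ where the pair $(\mathcal I,\mathcal O)$ can be represented in distribution as $$(\mathcal I,\mathcal O)\stackrel{d}{=}(1-J)(X_1,1+Y_1)+J(1+X_2,Y_2),$$ with: (i) $J$ a Bernoulli variable with $\mathbf P(J=1)=1-\mathbf P(J=0)=\gamma$; (ii) $$(X_1,Y_1)=\big(B^{(1)}(\delta_{\rm in},e^{-c_{\rm in}T}),\ \widetilde B^{(1)}(1+\delta_{\rm out},e^{-c_{\rm out}T})\big),$$ $$(X_2,Y_2)=\big(B^{(2)}(1+\delta_{\rm in},e^{-c_{\rm in}T}),\ \widetilde B^{(2)}(\delta_{\rm out},e^{-c_{\rm out}T})\big),$$ where $\{B^{(1)}(\delta_{\rm in},p)\}$, $\{B^{(2)}(1+\delta_{\rm in},p)\}$, $\{\widetilde B^{(1)}(1+\delta_{\rm out},p)\}$, $\{\widetilde B^{(2)}(\delta_{\rm out},p)\}$, $p\in(0,1)$, are four independent families of negative binomial variables and $T$ is an exponential random variable with unit mean, independent of $J$ and of the four families (and $J$ is independent of the families).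
   Context: Parameters: $\alpha\in(0,1)$, $\gamma=1-\alpha$, $\delta_{\rm in},\delta_{\rm out}>0$, $c_{\rm in}=\alpha/(1+\delta_{\rm in})$, $c_{\rm out}=\gamma/(1+\delta_{\rm out})$. Preferential attachment model: $G(1)$ has one node, labeled $1$, with a self loop (in-degree and out-degree both $1$). Given $G(n)$ with node set $[n]=\{1,\dots,n\}$ and $n$ directed edges, $G(n+1)$ is obtained by adding node $n+1$ and one directed edge: with probability $\alpha$ the edge goes from $n+1$ to $v\in[n]$, chosen with probability $\frac{D^{\rm in}_v(n)+\delta_{\rm in}}{(1+\delta_{\rm in})n}$; with probability $\gamma$ the edge goes from $v\in[n]$ to $n+1$, with $v$ chosen with probability $\frac{D^{\rm out}_v(n)+\delta_{\rm out}}{(1+\delta_{\rm out})n}$. Here $(D^{\rm in}_v(n),D^{\rm out}_v(n))$ are the in- and out-degree of $v$ in $G(n)$. For $a>0$, $p\in(0,1)$, a negative binomial variable $B(a,p)$ is a nonnegative-integer-valued random variable with generating function $\mathbf E(s^{B(a,p)})=p^a(1-(1-p)s)^{-a}$, $0\le s\le1$. For a $(0,1)$-valued random variable $Z$, $B(a,Z)$ denotes the mixture in which the second parameter is randomized by an independent $Z$: conditionally on $Z=p$ it is distributed as $B(a,p)$. In (ii) the same $T$ is used in all coordinates, and conditionally on $T$ the variables $X_1,Y_1,X_2,Y_2$ are independent. *)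

theory Defs
  imports "HOL-Probability.Probability" "Graph_Theory.Pair_Digraph"
begin

section \<open>The directed preferential attachment model\<close>

text \<open>
  A set of ordered pairs suffices as arc set: every new arc is incident to the node that is added
  together with it, so parallel arcs never occur.
\<close>

definition loop_graph :: "nat pair_pre_digraph" where
  "loop_graph = \<lparr> pverts = {1}, parcs = {(1, 1)} \<rparr>"

definition add_node_arc :: "nat pair_pre_digraph \<Rightarrow> nat \<Rightarrow> nat \<times> nat \<Rightarrow> nat pair_pre_digraph" where
  "add_node_arc g u e = \<lparr> pverts = insert u (pverts g), parcs = insert e (parcs g) \<rparr>"

abbreviation D_in :: "nat pair_pre_digraph \<Rightarrow> nat \<Rightarrow> nat" where
  "D_in g v \<equiv> in_degree (with_proj g) v"

abbreviation D_out :: "nat pair_pre_digraph \<Rightarrow> nat \<Rightarrow> nat" where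
  "D_out g v \<equiv> out_degree (with_proj g) v"

text \<open>
  The value \<open>G 0\<close> is irrelevant. The two kinds of transition below exhaust the conditional law of
  \<open>G (n + 1)\<close>: the in-degrees, and likewise the out-degrees, of a reachable graph with \<open>n\<close> nodes
  sum to \<open>n\<close>, and different choices of the direction and of \<open>v\<close> give different graphs.
  Conditioning on \<open>G n\<close> alone loses nothing, because the node labels in \<open>G n\<close> record the whole
  history \<open>G 1, \<dots>, G n\<close>.
\<close>

locale preferential_attachment = prob_space M for M :: "'w measure" +
  fixes \<alpha> \<gamma> \<delta>_in \<delta>_out :: real and G :: "nat \<Rightarrow> 'w \<Rightarrow> nat pair_pre_digraph"
  assumes random_graph: "\<And>n. n \<ge> 1 \<Longrightarrow> random_variable (count_space UNIV) (G n)"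
    and start: "AE \<omega> in M. G 1 \<omega> = loop_graph"
    and step_in: "\<And>n g v. n \<ge> 1 \<Longrightarrow> \<P>(\<omega> in M. G n \<omega> = g) > 0 \<Longrightarrow> v \<in> {1..n} \<Longrightarrow>
      \<P>(\<omega> in M. G (n + 1) \<omega> = add_node_arc g (n + 1) (n + 1, v) \<bar> G n \<omega> = g)
        = \<alpha> * ((real (D_in g v) + \<delta>_in) / ((1 + \<delta>_in) * real n))"
    and step_out: "\<And>n g v. n \<ge> 1 \<Longrightarrow> \<P>(\<omega> in M. G n \<omega> = g) > 0 \<Longrightarrow> v \<in> {1..n} \<Longrightarrow>
      \<P>(\<omega> in M. G (n + 1) \<omega> = add_node_arc g (n + 1) (v, n + 1) \<bar> G n \<omega> = g)
        = \<gamma> * ((real (D_out g v) + \<delta>_out) / ((1 + \<delta>_out) * real n))"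

definition node_count :: "nat \<Rightarrow> nat \<Rightarrow> nat pair_pre_digraph \<Rightarrow> nat" where
  "node_count i j g = card {v \<in> pverts g. D_in g v = i \<and> D_out g v = j}"

definition tendsto_in_prob :: "'w measure \<Rightarrow> (nat \<Rightarrow> 'w \<Rightarrow> real) \<Rightarrow> real \<Rightarrow> bool" where
  "tendsto_in_prob M X c \<longleftrightarrow> (\<forall>\<epsilon>>0. (\<lambda>n. \<P>(\<omega> in M. \<bar>X n \<omega> - c\<bar> > \<epsilon>)) \<longlonglongrightarrow> 0)"

section \<open>The limiting pair\<close>

text \<open>
  The library's \<open>neg_binomial_pmf\<close> only covers integer \<open>a\<close>, hence the definition through the
  generating function.
\<close>

definition is_neg_binomial :: "real \<Rightarrow> real \<Rightarrow> nat pmf \<Rightarrow> bool" where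
  "is_neg_binomial a p B \<longleftrightarrow>
     (\<forall>s\<in>{0..1}. measure_pmf.expectation B (\<lambda>k. s ^ k) = p powr a * (1 - (1 - p) * s) powr (- a))"

text \<open>
  \<open>B1 p\<close>, \<open>B2 p\<close>, \<open>C1 p\<close>, \<open>C2 p\<close> are the laws of the members with parameter \<open>p\<close> of the four
  families (\<open>C\<close> for the families written with a tilde). A family evaluated at a random parameter
  means the mixture, so \<open>mixture\<close> gives the conditional law of \<open>(X1, Y1, X2, Y2)\<close> given the
  sigma-algebra generated by \<open>T\<close>; its product form expresses the independence of the families
  from each other and from \<open>T\<close>. The values of the families outside \<open>(0, 1)\<close> do not matter,
  since \<open>T > 0\<close> almost surely.
\<close>

locale mixture_representation = prob_space \<Omega> for \<Omega> :: "'a measure" +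
  fixes \<gamma> \<delta>_in \<delta>_out c_in c_out :: real
    and B1 C1 B2 C2 :: "real \<Rightarrow> nat pmf"
    and J :: "'a \<Rightarrow> nat" and T :: "'a \<Rightarrow> real" and X1 Y1 X2 Y2 :: "'a \<Rightarrow> nat"
  assumes B1: "\<And>p. 0 < p \<Longrightarrow> p < 1 \<Longrightarrow> is_neg_binomial \<delta>_in p (B1 p)"
    and C1: "\<And>p. 0 < p \<Longrightarrow> p < 1 \<Longrightarrow> is_neg_binomial (1 + \<delta>_out) p (C1 p)"
    and B2: "\<And>p. 0 < p \<Longrightarrow> p < 1 \<Longrightarrow> is_neg_binomial (1 + \<delta>_in) p (B2 p)"
    and C2: "\<And>p. 0 < p \<Longrightarrow> p < 1 \<Longrightarrow> is_neg_binomial \<delta>_out p (C2 p)"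
    and rv: "random_variable (count_space UNIV) J"
      "random_variable (count_space UNIV) X1" "random_variable (count_space UNIV) Y1"
      "random_variable (count_space UNIV) X2" "random_variable (count_space UNIV) Y2"
    and J: "\<P>(\<omega> in \<Omega>. J \<omega> = 1) = \<gamma>" "\<P>(\<omega> in \<Omega>. J \<omega> = 0) = 1 - \<gamma>"
    and T: "distributed \<Omega> lborel T (exponential_density 1)"
    and mixture: "\<And>k l k' l'. AE \<omega> in \<Omega>.
      real_cond_exp \<Omega> (vimage_algebra (space \<Omega>) T borel)
        (indicator {\<omega> \<in> space \<Omega>. X1 \<omega> = k \<and> Y1 \<omega> = l \<and> X2 \<omega> = k' \<and> Y2 \<omega> = l'}) \<omega>
      = pmf (B1 (exp (- c_in * T \<omega>))) k * pmf (C1 (exp (- c_out * T \<omega>))) l *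
        pmf (B2 (exp (- c_in * T \<omega>))) k' * pmf (C2 (exp (- c_out * T \<omega>))) l'"
    and J_indep: "indep_set
      (sets (vimage_algebra (space \<Omega>) J (count_space UNIV)))
      (sets (vimage_algebra (space \<Omega>) (\<lambda>\<omega>. (T \<omega>, (X1 \<omega>, Y1 \<omega>, X2 \<omega>, Y2 \<omega>)))
        (borel \<Otimes>\<^sub>M count_space UNIV)))"

end

theory Submission
  imports Defs
begin

text \<open>
  Second moments suffice for the convergence. The counts satisfy
  \<open>E (N i j (n + 1) | G n) = N i j n + (r i N (i - 1) j n + s j N i (j - 1) n
  - (r (i + 1) + s (j + 1)) N i j n) / n + const\<close> with linear rates \<open>r\<close> and \<open>s\<close>. If \<open>p\<close> solves the
  corresponding stationary recursion and \<open>Y i j n = N i j n - p i j n\<close>, then, since the increments are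
  bounded and the \<open>Y i j n\<close> term of the drift has the right sign, \<open>E (Y i j (n + 1)\<^sup>2) - E (Y i j n\<^sup>2)\<close> is
  at most \<open>2 (r i E |Y (i - 1) j n| + s j E |Y i (j - 1) n|) + 9\<close>, which is \<open>o(n)\<close> by induction on \<open>i + j\<close>.

  The solution \<open>p\<close> is the law at an independent exponential time \<open>T\<close> of a pair of independent linear
  pure birth processes: their transition probabilities are negative binomial, and integrating the forward
  equations against \<open>exp (- t)\<close> gives the recursion. Here \<open>T\<close> is the logarithmic age of a uniformly
  chosen node.
\<close>

text \<open>The second moment of a deviation is bounded through first absolute moments of its two
  predecessors, and \<open>(E |Y|)^2 <= E (Y^2)\<close> turns the outcome back into a first moment,
  so the induction can run on \<open>E |Y| / n -> 0\<close> alone. The division by \<open>n\<close>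
  in the drift is absorbed by the trivial bound \<open>|Y| <= n\<close>. The price is a mere o(n^2)
  estimate of second moments, which is all that convergence of \<open>N / n\<close> in probability
  asks for.

  The model is given only through point probabilities of transitions. These add up to 1 over the
  arcs that can be added, so \<open>G n\<close> almost surely takes finitely many values and
  conditional expectations become finite sums over graphs and arcs.

  On the limit side the link is \<open>E u(T) = u(0) + E u'(T)\<close> for an exponential
  \<open>T\<close>: the value \<open>u(0)\<close> is the degree law of a newborn node, which is the
  constant in the drift. A node born with an arc in some direction starts that birth process at 1;
  shifting the process back to 0 raises its parameter by 1, hence \<open>1 + \<delta>_in\<close> and
  \<open>1 + \<delta>_out\<close>.\<close>

section \<open>Degree counts under the addition of an arc\<close>

text \<open>A finite set that contains all reachable graphs with \<open>n\<close> nodes.\<close>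

definition recursive_graphs :: "nat \<Rightarrow> nat pair_pre_digraph set" where
  "recursive_graphs n = {g. pverts g = {1..n} \<and> parcs g \<subseteq> {1..n} \<times> {1..n} \<and> card (parcs g) = n}"

definition new_arcs :: "nat \<Rightarrow> (nat \<times> nat) set" where
  "new_arcs n = (\<lambda>v. (n + 1, v)) ` {1..n} \<union> (\<lambda>v. (v, n + 1)) ` {1..n}"

definition has_degrees :: "nat \<Rightarrow> nat \<Rightarrow> nat pair_pre_digraph \<Rightarrow> nat \<Rightarrow> real" where
  "has_degrees i j g v = of_bool (D_in g v = i \<and> D_out g v = j)"

lemma finite_recursive_graphs: "finite (recursive_graphs n)"
proof -
  have "recursive_graphs n \<subseteq> (\<lambda>(V, A). \<lparr>pverts = V, parcs = A\<rparr>) ` ({{1..n}} \<times> Pow ({1..n} \<times> {1..n}))"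
  proof
    fix g assume "g \<in> recursive_graphs n"
    then show "g \<in> (\<lambda>(V, A). \<lparr>pverts = V, parcs = A\<rparr>) ` ({{1..n}} \<times> Pow ({1..n} \<times> {1..n}))"
      by (cases g) (auto simp: recursive_graphs_def)
  qed
  then show ?thesis
    by (rule finite_subset) auto
qed

text \<open>The two orientations never give the same arc, because \<open>v\<close> stays below
  \<open>n + 1\<close>.\<close>

lemma sum_new_arcs: "(\<Sum>e\<in>new_arcs n. h e) = (\<Sum>v=1..n. h (n + 1, v)) + (\<Sum>v=1..n. h (v, n + 1))"
  unfolding new_arcs_def
  by (subst sum.union_disjoint) (auto simp: sum.reindex inj_on_def)

lemma finite_new_arcs: "finite (new_arcs n)"
  by (simp add: new_arcs_def)

lemma D_in_conv_card: "D_in g v = card {e \<in> parcs g. snd e = v}"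
  by (simp add: in_degree_def in_arcs_def)

lemma D_out_conv_card: "D_out g v = card {e \<in> parcs g. fst e = v}"
  by (simp add: out_degree_def out_arcs_def)

context
  fixes n g
  assumes g: "g \<in> recursive_graphs n"
begin

lemma finite_parcs: "finite (parcs g)"
  using g finite_subset by (fastforce simp: recursive_graphs_def)

lemma new_arcs_fresh: "e \<in> new_arcs n \<Longrightarrow> e \<notin> parcs g"
  using g by (auto simp: recursive_graphs_def new_arcs_def)

text \<open>The added arc can be read off as the one arc that is not in \<open>g\<close>.
  Transitions along different arcs are therefore disjoint events, whose probabilities add.\<close>

lemma inj_on_add_node_arc: "inj_on (add_node_arc g u) (new_arcs n)"
proof (rule inj_onI)
  fix e e'
  assume e: "e \<in> new_arcs n" "e' \<in> new_arcs n" and eq: "add_node_arc g u e = add_node_arc g u e'"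
  from eq have "insert e (parcs g) = insert e' (parcs g)"
    by (simp add: add_node_arc_def)
  with e[THEN new_arcs_fresh] show "e = e'"
    by blast
qed

lemma add_node_arc_recursive:
  assumes "e \<in> new_arcs n"
  shows "add_node_arc g (n + 1) e \<in> recursive_graphs (n + 1)"
  using g finite_parcs new_arcs_fresh[OF assms] assms
  by (auto simp: recursive_graphs_def add_node_arc_def new_arcs_def)

text \<open>Every arc has exactly one head in \<open>{1..n}\<close>, and there are \<open>n\<close>
  arcs. Together with \<open>sum_D_out\<close> this normalises the attachment probabilities.\<close>

lemma sum_D_in: "(\<Sum>v=1..n. D_in g v) = n"
proof -
  have "(\<Sum>v=1..n. D_in g v) = card (\<Union>v\<in>{1..n}. {e \<in> parcs g. snd e = v})"
    unfolding D_in_conv_card by (intro card_UN_disjoint[symmetric]) (auto simp: finite_parcs)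
  also have "(\<Union>v\<in>{1..n}. {e \<in> parcs g. snd e = v}) = parcs g"
    using g by (auto simp: recursive_graphs_def)
  finally show ?thesis
    using g by (simp add: recursive_graphs_def)
qed

lemma sum_D_out: "(\<Sum>v=1..n. D_out g v) = n"
proof -
  have "(\<Sum>v=1..n. D_out g v) = card (\<Union>v\<in>{1..n}. {e \<in> parcs g. fst e = v})"
    unfolding D_out_conv_card by (intro card_UN_disjoint[symmetric]) (auto simp: finite_parcs)
  also have "(\<Union>v\<in>{1..n}. {e \<in> parcs g. fst e = v}) = parcs g"
    using g by (auto simp: recursive_graphs_def)
  finally show ?thesis
    using g by (simp add: recursive_graphs_def)
qed

lemma D_in_fresh: "D_in g (Suc n) = 0"
proof -
  have "{e \<in> parcs g. snd e = Suc n} = {}"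
    using g by (auto simp: recursive_graphs_def)
  then show ?thesis
    unfolding D_in_conv_card by (simp only: card.empty)
qed

lemma D_out_fresh: "D_out g (Suc n) = 0"
proof -
  have "{e \<in> parcs g. fst e = Suc n} = {}"
    using g by (auto simp: recursive_graphs_def)
  then show ?thesis
    unfolding D_out_conv_card by (simp only: card.empty)
qed

lemma D_in_add_node_arc:
  assumes "e \<in> new_arcs n"
  shows "D_in (add_node_arc g u e) v = D_in g v + of_bool (snd e = v)"
proof -
  have "{e' \<in> insert e (parcs g). snd e' = v} =
      (if snd e = v then insert e {e' \<in> parcs g. snd e' = v} else {e' \<in> parcs g. snd e' = v})"
    by auto
  then show ?thesis
    using new_arcs_fresh[OF assms] finite_parcs
    by (simp add: D_in_conv_card add_node_arc_def)
qed

lemma D_out_add_node_arc: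
  assumes "e \<in> new_arcs n"
  shows "D_out (add_node_arc g u e) v = D_out g v + of_bool (fst e = v)"
proof -
  have "{e' \<in> insert e (parcs g). fst e' = v} =
      (if fst e = v then insert e {e' \<in> parcs g. fst e' = v} else {e' \<in> parcs g. fst e' = v})"
    by auto
  then show ?thesis
    using new_arcs_fresh[OF assms] finite_parcs
    by (simp add: D_out_conv_card add_node_arc_def)
qed

lemma node_count_conv_sum: "real (node_count i j g) = (\<Sum>v=1..n. has_degrees i j g v)"
proof -
  have "{v \<in> pverts g. D_in g v = i \<and> D_out g v = j} = {1..n} \<inter> {v. D_in g v = i \<and> D_out g v = j}"
    using g by (auto simp: recursive_graphs_def)
  then show ?thesis
    by (simp add: node_count_def has_degrees_def of_bool_def sum.If_cases)
qed

lemma node_count_le: "node_count i j g \<le> n"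
proof -
  have "node_count i j g \<le> card {1..n}"
    unfolding node_count_def using g by (intro card_mono) (auto simp: recursive_graphs_def)
  then show ?thesis by simp
qed

end

text \<open>Writing \<open>Suc (D_in g v) = i\<close> instead of \<open>D_in g v = i - 1\<close>
  makes the indicator vanish at \<open>i = 0\<close>, a degree that no node can reach by a
  jump.\<close>

definition has_degrees_in_pred :: "nat \<Rightarrow> nat \<Rightarrow> nat pair_pre_digraph \<Rightarrow> nat \<Rightarrow> real" where
  "has_degrees_in_pred i j g v = of_bool (Suc (D_in g v) = i \<and> D_out g v = j)"

definition has_degrees_out_pred :: "nat \<Rightarrow> nat \<Rightarrow> nat pair_pre_digraph \<Rightarrow> nat \<Rightarrow> real" where
  "has_degrees_out_pred i j g v = of_bool (D_in g v = i \<and> Suc (D_out g v) = j)"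

text \<open>Only two nodes matter: \<open>v\<close>, whose in-degree rises by 1, and the newcomer,
  which is born with in-degree 0 and out-degree 1.\<close>

lemma node_count_add_in_arc:
  assumes g: "g \<in> recursive_graphs n" and v: "v \<in> {1..n}"
  shows "real (node_count i j (add_node_arc g (n + 1) (n + 1, v))) =
    real (node_count i j g) - has_degrees i j g v + has_degrees_in_pred i j g v + of_bool (i = 0 \<and> j = 1)"
proof -
  have e: "(Suc n, v) \<in> new_arcs n"
    using v by (auto simp: new_arcs_def)
  let ?g = "add_node_arc g (n + 1) (n + 1, v)"
  have "real (node_count i j ?g) = (\<Sum>u=1..n+1. has_degrees i j ?g u)"
    using node_count_conv_sum[OF add_node_arc_recursive[OF g e]] by simp
  also have "\<dots> = (\<Sum>u=1..n. has_degrees i j ?g u) + of_bool (i = 0 \<and> j = 1)"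
    using v by (auto simp: has_degrees_def D_in_add_node_arc[OF g e] D_out_add_node_arc[OF g e]
        D_in_fresh[OF g] D_out_fresh[OF g])
  also have "(\<Sum>u=1..n. has_degrees i j ?g u) =
      (\<Sum>u=1..n. has_degrees i j g u + (if u = v then has_degrees_in_pred i j g v - has_degrees i j g v else 0))"
    by (rule sum.cong) (auto simp: has_degrees_def has_degrees_in_pred_def
        D_in_add_node_arc[OF g e] D_out_add_node_arc[OF g e])
  also have "\<dots> = real (node_count i j g) + (has_degrees_in_pred i j g v - has_degrees i j g v)"
    using v by (simp add: sum.distrib node_count_conv_sum[OF g])
  finally show ?thesis by simp
qed

lemma node_count_add_out_arc:
  assumes g: "g \<in> recursive_graphs n" and v: "v \<in> {1..n}"
  shows "real (node_count i j (add_node_arc g (n + 1) (v, n + 1))) =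
    real (node_count i j g) - has_degrees i j g v + has_degrees_out_pred i j g v + of_bool (i = 1 \<and> j = 0)"
proof -
  have e: "(v, Suc n) \<in> new_arcs n"
    using v by (auto simp: new_arcs_def)
  let ?g = "add_node_arc g (n + 1) (v, n + 1)"
  have "real (node_count i j ?g) = (\<Sum>u=1..n+1. has_degrees i j ?g u)"
    using node_count_conv_sum[OF add_node_arc_recursive[OF g e]] by simp
  also have "\<dots> = (\<Sum>u=1..n. has_degrees i j ?g u) + of_bool (i = 1 \<and> j = 0)"
    using v by (auto simp: has_degrees_def D_in_add_node_arc[OF g e] D_out_add_node_arc[OF g e]
        D_in_fresh[OF g] D_out_fresh[OF g])
  also have "(\<Sum>u=1..n. has_degrees i j ?g u) =
      (\<Sum>u=1..n. has_degrees i j g u + (if u = v then has_degrees_out_pred i j g v - has_degrees i j g v else 0))"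
    by (rule sum.cong) (auto simp: has_degrees_def has_degrees_out_pred_def
        D_in_add_node_arc[OF g e] D_out_add_node_arc[OF g e])
  also have "\<dots> = real (node_count i j g) + (has_degrees_out_pred i j g v - has_degrees i j g v)"
    using v by (simp add: sum.distrib node_count_conv_sum[OF g])
  finally show ?thesis by simp
qed

section \<open>One-step drift of the degree counts\<close>

text \<open>
  The rate of the jump from degree \<open>k - 1\<close> to degree \<open>k\<close>. It vanishes at \<open>k = 0\<close>, which makes the
  truncated \<open>k - 1\<close> harmless in the recursions below.
\<close>

definition attach_rate :: "real \<Rightarrow> real \<Rightarrow> nat \<Rightarrow> real" where
  "attach_rate c \<delta> k = (if k = 0 then 0 else c * (real k - 1 + \<delta>))"

lemma attach_rate_simps [simp]:
  "attach_rate c \<delta> 0 = 0" "attach_rate c \<delta> (Suc k) = c * (real k + \<delta>)"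
  by (simp_all add: attach_rate_def)

lemma attach_rate_nonneg: "c \<ge> 0 \<Longrightarrow> \<delta> \<ge> 0 \<Longrightarrow> attach_rate c \<delta> k \<ge> 0"
  by (cases k) auto

locale attachment_parameters =
  fixes \<alpha> \<gamma> \<delta>_in \<delta>_out :: real
  assumes alpha: "0 < \<alpha>" "\<alpha> < 1" and gamma: "\<gamma> = 1 - \<alpha>"
    and delta: "\<delta>_in > 0" "\<delta>_out > 0"
begin

definition c_in :: real where "c_in = \<alpha> / (1 + \<delta>_in)"
definition c_out :: real where "c_out = \<gamma> / (1 + \<delta>_out)"

definition rate_in :: "nat \<Rightarrow> real" where
  "rate_in = attach_rate c_in \<delta>_in"

definition rate_out :: "nat \<Rightarrow> real" where
  "rate_out = attach_rate c_out \<delta>_out"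

text \<open>The conditional probability of adding \<open>e\<close>, in one formula for both
  orientations. The test on \<open>fst e\<close> separates them on \<open>new_arcs n\<close>, where
  the other endpoint is at most \<open>n\<close>.\<close>

definition arc_weight :: "nat \<Rightarrow> nat pair_pre_digraph \<Rightarrow> nat \<times> nat \<Rightarrow> real" where
  "arc_weight n g e =
     (if fst e = n + 1 then \<alpha> * ((real (D_in g (snd e)) + \<delta>_in) / ((1 + \<delta>_in) * real n))
      else \<gamma> * ((real (D_out g (fst e)) + \<delta>_out) / ((1 + \<delta>_out) * real n)))"

text \<open>The expected contribution of the newcomer itself; it reappears as the value of
  \<open>degree_prob\<close> at time 0.\<close>

definition arc_source :: "nat \<Rightarrow> nat \<Rightarrow> real" where
  "arc_source i j = \<alpha> * of_bool (i = 0 \<and> j = 1) + \<gamma> * of_bool (i = 1 \<and> j = 0)"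

lemma gamma_pos: "\<gamma> > 0"
  using alpha gamma by simp

lemma c_pos: "c_in > 0" "c_out > 0"
  using alpha gamma_pos delta by (auto simp: c_in_def c_out_def)

lemma rate_nonneg: "rate_in k \<ge> 0" "rate_out k \<ge> 0"
  using c_pos delta by (auto simp: rate_in_def rate_out_def intro!: attach_rate_nonneg)

lemma arc_weight_nonneg: "arc_weight n g e \<ge> 0"
  using alpha gamma_pos delta by (auto simp: arc_weight_def)

text \<open>The degrees sum to \<open>n\<close>, so the numerators sum to
  \<open>(1 + \<delta>_in) * n\<close> and \<open>(1 + \<delta>_out) * n\<close> and cancel the
  denominators. Total mass 1 is what later excludes any other transition.\<close>

lemma
  assumes g: "g \<in> recursive_graphs n" and n: "n \<ge> 1"
  shows sum_arc_weight_in: "(\<Sum>v=1..n. arc_weight n g (n + 1, v)) = \<alpha>"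
    and sum_arc_weight_out: "(\<Sum>v=1..n. arc_weight n g (v, n + 1)) = \<gamma>"
    and sum_arc_weight: "(\<Sum>e\<in>new_arcs n. arc_weight n g e) = 1"
proof -
  have "(\<Sum>v=1..n. arc_weight n g (n + 1, v)) =
      \<alpha> / ((1 + \<delta>_in) * real n) * (\<Sum>v=1..n. real (D_in g v) + \<delta>_in)"
    by (simp add: arc_weight_def sum_distrib_left)
  also have "(\<Sum>v=1..n. real (D_in g v) + \<delta>_in) = (1 + \<delta>_in) * real n"
    using sum_D_in[OF g] by (simp add: sum.distrib algebra_simps flip: of_nat_sum)
  finally show 1: "(\<Sum>v=1..n. arc_weight n g (n + 1, v)) = \<alpha>"
    using n delta by simp
  have "(\<Sum>v=1..n. arc_weight n g (v, n + 1)) =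
      \<gamma> / ((1 + \<delta>_out) * real n) * (\<Sum>v=1..n. real (D_out g v) + \<delta>_out)"
    by (simp add: arc_weight_def sum_distrib_left)
  also have "(\<Sum>v=1..n. real (D_out g v) + \<delta>_out) = (1 + \<delta>_out) * real n"
    using sum_D_out[OF g] by (simp add: sum.distrib algebra_simps flip: of_nat_sum)
  finally show 2: "(\<Sum>v=1..n. arc_weight n g (v, n + 1)) = \<gamma>"
    using n delta by simp
  show "(\<Sum>e\<in>new_arcs n. arc_weight n g e) = 1"
    using 1 2 by (simp add: sum_new_arcs gamma)
qed

text \<open>Where the indicator is 1 the weight depends on the degree alone, so each sum is a
  constant times a count. The predecessor indicators pick out degree \<open>i - 1\<close> or
  \<open>j - 1\<close>; at 0 both sides vanish.\<close>

lemma arc_weight_has_degrees: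
  assumes g: "g \<in> recursive_graphs n"
  shows "(\<Sum>v=1..n. arc_weight n g (n + 1, v) * has_degrees i j g v) =
           rate_in (Suc i) * real (node_count i j g) / real n"
    and "(\<Sum>v=1..n. arc_weight n g (v, n + 1) * has_degrees i j g v) =
           rate_out (Suc j) * real (node_count i j g) / real n"
    and "(\<Sum>v=1..n. arc_weight n g (n + 1, v) * has_degrees_in_pred i j g v) =
           rate_in i * real (node_count (i - 1) j g) / real n"
    and "(\<Sum>v=1..n. arc_weight n g (v, n + 1) * has_degrees_out_pred i j g v) =
           rate_out j * real (node_count i (j - 1) g) / real n"
proof -
  have *: "r * real (node_count k l g) / real n = (\<Sum>v=1..n. r * has_degrees k l g v / real n)" for r k l
    by (simp add: node_count_conv_sum[OF g] sum_distrib_left sum_divide_distrib)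
  show "(\<Sum>v=1..n. arc_weight n g (n + 1, v) * has_degrees i j g v) =
      rate_in (Suc i) * real (node_count i j g) / real n"
    unfolding * by (intro sum.cong refl) (auto simp: arc_weight_def has_degrees_def rate_in_def c_in_def)
  show "(\<Sum>v=1..n. arc_weight n g (v, n + 1) * has_degrees i j g v) =
      rate_out (Suc j) * real (node_count i j g) / real n"
    unfolding * by (intro sum.cong refl) (auto simp: arc_weight_def has_degrees_def rate_out_def c_out_def simp del: One_nat_def)
  show "(\<Sum>v=1..n. arc_weight n g (n + 1, v) * has_degrees_in_pred i j g v) =
      rate_in i * real (node_count (i - 1) j g) / real n"
    unfolding * by (intro sum.cong refl, cases i)
      (auto simp: arc_weight_def has_degrees_def has_degrees_in_pred_def rate_in_def c_in_def)
  show "(\<Sum>v=1..n. arc_weight n g (v, n + 1) * has_degrees_out_pred i j g v) =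
      rate_out j * real (node_count i (j - 1) g) / real n"
    unfolding * by (intro sum.cong refl, cases j)
      (auto simp: arc_weight_def has_degrees_def has_degrees_out_pred_def rate_out_def c_out_def)
qed

text \<open>This is the conditional expectation of the increment given \<open>G n = g\<close>. The
  rate terms come from \<open>v\<close> entering or leaving the class \<open>(i, j)\<close>, the
  constant from the newcomer.\<close>

lemma node_count_drift:
  assumes g: "g \<in> recursive_graphs n" and n: "n \<ge> 1"
  shows "(\<Sum>e\<in>new_arcs n. arc_weight n g e * (real (node_count i j (add_node_arc g (n + 1) e)) - real (node_count i j g))) =
    (rate_in i * real (node_count (i - 1) j g) + rate_out j * real (node_count i (j - 1) g)
      - (rate_in (Suc i) + rate_out (Suc j)) * real (node_count i j g)) / real n + arc_source i j"
proof -
  have 1: "(\<Sum>v=1..n. arc_weight n g (n + 1, v) *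
        (real (node_count i j (add_node_arc g (n + 1) (n + 1, v))) - real (node_count i j g))) =
      (\<Sum>v=1..n. arc_weight n g (n + 1, v) * has_degrees_in_pred i j g v
        - arc_weight n g (n + 1, v) * has_degrees i j g v
        + arc_weight n g (n + 1, v) * of_bool (i = 0 \<and> j = 1))"
    by (intro sum.cong refl, subst node_count_add_in_arc[OF g]) (auto simp: algebra_simps)
  have 2: "(\<Sum>v=1..n. arc_weight n g (v, n + 1) *
        (real (node_count i j (add_node_arc g (n + 1) (v, n + 1))) - real (node_count i j g))) =
      (\<Sum>v=1..n. arc_weight n g (v, n + 1) * has_degrees_out_pred i j g v
        - arc_weight n g (v, n + 1) * has_degrees i j g v
        + arc_weight n g (v, n + 1) * of_bool (i = 1 \<and> j = 0))"
    by (intro sum.cong refl, subst node_count_add_out_arc[OF g]) (auto simp: algebra_simps)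
  show ?thesis
    unfolding sum_new_arcs 1 2 sum.distrib sum_subtractf arc_weight_has_degrees[OF g]
      sum_distrib_right[symmetric] sum_arc_weight_in[OF g n] sum_arc_weight_out[OF g n]
    by (simp add: arc_source_def field_simps add_divide_distrib diff_divide_distrib)
qed

text \<open>There is a loss of at most 1 at \<open>v\<close>, a gain of at most 1 at
  \<open>v\<close> and a gain of at most 1 from the newcomer, so the change lies between -1 and
  2.\<close>

lemma node_count_increment_le:
  assumes g: "g \<in> recursive_graphs n" and e: "e \<in> new_arcs n"
  shows "\<bar>real (node_count i j (add_node_arc g (n + 1) e)) - real (node_count i j g)\<bar> \<le> 2"
proof -
  from e consider v where "v \<in> {1..n}" "e = (n + 1, v)" | v where "v \<in> {1..n}" "e = (v, n + 1)"
    by (auto simp: new_arcs_def)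
  then show ?thesis
  proof cases
    case 1
    then show ?thesis
      using node_count_add_in_arc[OF g 1(1), of i j]
      by (auto simp: has_degrees_def has_degrees_in_pred_def)
  next
    case 2
    then show ?thesis
      using node_count_add_out_arc[OF g 2(1), of i j]
      by (auto simp: has_degrees_def has_degrees_out_pred_def)
  qed
qed

end

text \<open>Abstracting \<open>p\<close> separates the moment estimates from the explicit solution.
  If the counts were equal to \<open>p i j * n\<close>, their drift would have to be
  \<open>p i j\<close> per step; this growth is the \<open>1\<close> in the left-hand factor of
  \<open>p_rec\<close>.\<close>

locale limiting_frequencies = attachment_parameters +
  fixes p :: "nat \<Rightarrow> nat \<Rightarrow> real"
  assumes p_bounds: "0 \<le> p i j" "p i j \<le> 1"
    and p_rec: "(1 + rate_in (Suc i) + rate_out (Suc j)) * p i j =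
      rate_in i * p (i - 1) j + rate_out j * p i (j - 1) + arc_source i j"
begin

definition deviation :: "nat \<Rightarrow> nat \<Rightarrow> nat \<Rightarrow> nat pair_pre_digraph \<Rightarrow> real" where
  "deviation n i j g = real (node_count i j g) - p i j * real n"

text \<open>Crude, but of the order that cancels the factor \<open>1 / n\<close> of the drift when
  the second moment is expanded.\<close>

lemma abs_deviation_le:
  assumes "g \<in> recursive_graphs n"
  shows "\<bar>deviation n i j g\<bar> \<le> real n"
proof -
  have "real (node_count i j g) \<le> real n"
    using node_count_le[OF assms] by simp
  moreover have "0 \<le> p i j * real n" "p i j * real n \<le> 1 * real n"
    using p_bounds by (simp, intro mult_right_mono, auto)
  ultimately show ?thesis
    by (simp add: deviation_def abs_le_iff)
qed

text \<open>By \<open>p_rec\<close> the newcomer term, the growth of \<open>p i j * n\<close> and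
  the drift evaluated at \<open>p\<close> cancel. What remains is linear and homogeneous in the
  deviations.\<close>

lemma deviation_drift:
  assumes g: "g \<in> recursive_graphs n" and n: "n \<ge> 1"
  shows "(\<Sum>e\<in>new_arcs n. arc_weight n g e * (deviation (n + 1) i j (add_node_arc g (n + 1) e) - deviation n i j g)) =
    (rate_in i * deviation n (i - 1) j g + rate_out j * deviation n i (j - 1) g
      - (rate_in (Suc i) + rate_out (Suc j)) * deviation n i j g) / real n"
proof -
  have "(\<Sum>e\<in>new_arcs n. arc_weight n g e * (deviation (n + 1) i j (add_node_arc g (n + 1) e) - deviation n i j g)) =
     (\<Sum>e\<in>new_arcs n. arc_weight n g e * (real (node_count i j (add_node_arc g (n + 1) e)) - real (node_count i j g))
        - arc_weight n g e * p i j)"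
    by (intro sum.cong refl) (simp add: deviation_def algebra_simps)
  also have "\<dots> = (rate_in i * real (node_count (i - 1) j g) + rate_out j * real (node_count i (j - 1) g)
      - (rate_in (Suc i) + rate_out (Suc j)) * real (node_count i j g)) / real n + arc_source i j - p i j"
    unfolding sum_subtractf node_count_drift[OF g n] sum_distrib_right[symmetric] sum_arc_weight[OF g n] by simp
  finally have eq: "(\<Sum>e\<in>new_arcs n. arc_weight n g e * (deviation (n + 1) i j (add_node_arc g (n + 1) e) - deviation n i j g)) = \<dots>" .
  have source: "arc_source i j = p i j + (rate_in (Suc i) + rate_out (Suc j)) * p i j
      - (rate_in i * p (i - 1) j + rate_out j * p i (j - 1))"
    using p_rec[of i j] by (simp add: algebra_simps)
  show ?thesis
    using n unfolding eq source unfolding deviation_def by (simp add: field_simps)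
qed

lemma deviation_second_moment_step:
  assumes g: "g \<in> recursive_graphs n" and n: "n \<ge> 1"
  shows "(\<Sum>e\<in>new_arcs n. arc_weight n g e * (deviation (n + 1) i j (add_node_arc g (n + 1) e))\<^sup>2) \<le>
    (deviation n i j g)\<^sup>2 + 2 * (rate_in i * \<bar>deviation n (i - 1) j g\<bar> + rate_out j * \<bar>deviation n i (j - 1) g\<bar>) + 9"
proof -
  define y where "y = deviation n i j g"
  define d where "d e = deviation (n + 1) i j (add_node_arc g (n + 1) e) - y" for e
  define R where "R = rate_in i * deviation n (i - 1) j g + rate_out j * deviation n i (j - 1) g"
  define R' where "R' = rate_in i * \<bar>deviation n (i - 1) j g\<bar> + rate_out j * \<bar>deviation n i (j - 1) g\<bar>"
  define c where "c = rate_in (Suc i) + rate_out (Suc j)"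
  have c: "c \<ge> 0" and R': "\<bar>R\<bar> \<le> R'"
    using rate_nonneg by (auto simp: c_def R_def R'_def abs_mult intro!: abs_triangle_ineq[THEN order_trans] add_mono)
  have y: "\<bar>y\<bar> \<le> real n"
    using abs_deviation_le[OF g] by (simp add: y_def)
  have drift: "(\<Sum>e\<in>new_arcs n. arc_weight n g e * d e) = (R - c * y) / real n"
    using deviation_drift[OF g n, of i j] by (simp add: d_def y_def R_def c_def)
  \<comment> \<open>The count moves by at most 2 and \<open>p i j * n\<close> by at most 1; 9 is the
    square of 3.\<close>
  have d: "(d e)\<^sup>2 \<le> 9" if "e \<in> new_arcs n" for e
  proof -
    have "\<bar>d e\<bar> \<le> 3"
      using node_count_increment_le[OF g that, of i j] p_bounds[of i j]
      by (auto simp: d_def y_def deviation_def algebra_simps abs_le_iff)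
    then have "(d e)\<^sup>2 \<le> 3\<^sup>2"
      by (intro abs_le_square_iff[THEN iffD1]) auto
    then show ?thesis by simp
  qed
  have "(\<Sum>e\<in>new_arcs n. arc_weight n g e * (deviation (n + 1) i j (add_node_arc g (n + 1) e))\<^sup>2) =
      (\<Sum>e\<in>new_arcs n. arc_weight n g e * y\<^sup>2 + (2 * y) * (arc_weight n g e * d e) + arc_weight n g e * (d e)\<^sup>2)"
    by (intro sum.cong refl) (simp add: d_def power2_eq_square algebra_simps)
  also have "\<dots> = y\<^sup>2 + 2 * y * ((R - c * y) / real n) + (\<Sum>e\<in>new_arcs n. arc_weight n g e * (d e)\<^sup>2)"
    by (simp only: sum.distrib sum_distrib_left[symmetric] sum_distrib_right[symmetric]
        drift sum_arc_weight[OF g n] mult_1)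
  also have "(\<Sum>e\<in>new_arcs n. arc_weight n g e * (d e)\<^sup>2) \<le> (\<Sum>e\<in>new_arcs n. arc_weight n g e * 9)"
    using d by (intro sum_mono mult_left_mono arc_weight_nonneg)
  also have "\<dots> = 9"
    by (simp add: sum_distrib_right[symmetric] sum_arc_weight[OF g n])
  \<comment> \<open>The term with \<open>- c * y\<^sup>2\<close> is dropped by its sign, and the
    bound of \<open>y\<close> by \<open>n\<close> pays for the division by \<open>n\<close>.\<close>
  also have "2 * y * ((R - c * y) / real n) \<le> 2 * R'"
  proof -
    have "y * (R - c * y) \<le> y * R"
      using c by (simp add: algebra_simps)
    also have "\<dots> \<le> \<bar>y\<bar> * \<bar>R\<bar>"
      using abs_ge_self[of "y * R"] by (simp add: abs_mult)
    also have "\<dots> \<le> real n * R'"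
      using y R' by (intro mult_mono) auto
    finally show ?thesis
      using n by (simp add: field_simps)
  qed
  finally show ?thesis
    by (simp add: y_def R'_def)
qed

end

section \<open>Convergence in probability\<close>

text \<open>From some \<open>m\<close> on, each increment is at most
  \<open>\<epsilon> / 2 * n\<close>, which is below the one-step growth of
  \<open>\<epsilon> / 2 * n\<^sup>2\<close>. The starting value \<open>y m\<close> is negligible
  against \<open>n\<^sup>2\<close>.\<close>

lemma quadratic_growth_of_increments:
  fixes y r :: "nat \<Rightarrow> real"
  assumes nonneg: "\<And>n. y n \<ge> 0"
    and step: "\<And>n. n \<ge> 1 \<Longrightarrow> y (Suc n) \<le> y n + r n"
    and r: "(\<lambda>n. r n / real n) \<longlonglongrightarrow> 0"
  shows "(\<lambda>n. y n / (real n)\<^sup>2) \<longlonglongrightarrow> 0"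
proof (rule LIMSEQ_I)
  fix \<epsilon> :: real assume "\<epsilon> > 0"
  then have "\<forall>\<^sub>F n in sequentially. \<bar>r n / real n\<bar> < \<epsilon> / 2"
    using r by (auto simp: tendsto_iff dist_real_def dest: spec[of _ "\<epsilon> / 2"])
  then obtain m where m: "m \<ge> 1" "\<And>n. n \<ge> m \<Longrightarrow> \<bar>r n / real n\<bar> < \<epsilon> / 2"
    unfolding eventually_sequentially by (metis le_trans linorder_le_cases)
  have bound: "y n \<le> y m + \<epsilon> / 2 * (real n)\<^sup>2" if "n \<ge> m" for n
    using that
  proof (induction n rule: dec_induct)
    case base
    then show ?case using \<open>\<epsilon> > 0\<close> by simp
  next
    case (step n)
    have "r n \<le> \<epsilon> / 2 * real n"
      using m(2)[of n] step m(1) by (simp add: abs_less_iff field_simps)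
    then have "y (Suc n) \<le> y m + \<epsilon> / 2 * (real n)\<^sup>2 + \<epsilon> / 2 * real n"
      using assms(2)[of n] step m(1) by simp
    also have "\<dots> \<le> y m + \<epsilon> / 2 * (real (Suc n))\<^sup>2"
      using \<open>\<epsilon> > 0\<close> by (simp add: power2_eq_square algebra_simps)
    finally show ?case .
  qed
  have "(\<lambda>n. y m / (real n)\<^sup>2) \<longlonglongrightarrow> 0"
    by real_asymp
  then have "\<forall>\<^sub>F n in sequentially. \<bar>y m / (real n)\<^sup>2\<bar> < \<epsilon> / 2"
    using \<open>\<epsilon> > 0\<close> by (auto simp: tendsto_iff dist_real_def dest: spec[of _ "\<epsilon> / 2"])
  then have "\<forall>\<^sub>F n in sequentially. norm (y n / (real n)\<^sup>2 - 0) < \<epsilon>"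
    using eventually_ge_at_top[of m]
  proof eventually_elim
    case (elim n)
    have "y n / (real n)\<^sup>2 \<le> (y m + \<epsilon> / 2 * (real n)\<^sup>2) / (real n)\<^sup>2"
      using bound[OF elim(2)] by (intro divide_right_mono) auto
    also have "\<dots> = y m / (real n)\<^sup>2 + \<epsilon> / 2"
      using m(1) elim(2) by (simp add: add_divide_distrib)
    also have "\<dots> < \<epsilon>"
      using elim(1) by linarith
    finally show ?case
      using nonneg[of n] by simp
  qed
  then show "\<exists>N. \<forall>n\<ge>N. norm (y n / (real n)\<^sup>2 - 0) < \<epsilon>"
    by (simp add: eventually_sequentially)
qed

section \<open>From transition probabilities to one-step expectations\<close>

locale attachment_model =
  preferential_attachment M \<alpha> \<gamma> \<delta>_in \<delta>_out G + attachment_parameters \<alpha> \<gamma> \<delta>_in \<delta>_out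
  for M :: "'w measure" and \<alpha> \<gamma> \<delta>_in \<delta>_out G
begin

text \<open>A graph of probability 0 makes both sides vanish, so the product form extends
  \<open>step_in\<close> and \<open>step_out\<close> to every \<open>g\<close>.\<close>

lemma prob_step:
  assumes n: "n \<ge> 1" and e: "e \<in> new_arcs n"
  shows "\<P>(\<omega> in M. G n \<omega> = g \<and> G (n + 1) \<omega> = add_node_arc g (n + 1) e) =
    \<P>(\<omega> in M. G n \<omega> = g) * arc_weight n g e"
proof (cases "\<P>(\<omega> in M. G n \<omega> = g) > 0")
  case True
  from e consider v where "v \<in> {1..n}" "e = (n + 1, v)" | v where "v \<in> {1..n}" "e = (v, n + 1)"
    by (auto simp: new_arcs_def)
  then have "\<P>(\<omega> in M. G (n + 1) \<omega> = add_node_arc g (n + 1) e \<bar> G n \<omega> = g) = arc_weight n g e"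
  proof cases
    case 1
    then show ?thesis
      using step_in[OF n True 1(1)] by (simp add: arc_weight_def)
  next
    case 2
    then show ?thesis
      using step_out[OF n True 2(1)] by (simp add: arc_weight_def)
  qed
  then show ?thesis
    using True by (simp add: cond_prob_def field_simps conj_commute)
next
  case False
  then have 0: "\<P>(\<omega> in M. G n \<omega> = g) = 0"
    using measure_nonneg[of M] by (simp add: not_less antisym)
  have "\<P>(\<omega> in M. G n \<omega> = g \<and> G (n + 1) \<omega> = add_node_arc g (n + 1) e) \<le> \<P>(\<omega> in M. G n \<omega> = g)"
    using measurable_sets_Collect[OF random_graph[OF n], of "\<lambda>x. x = g"] by (intro finite_measure_mono) auto
  with 0 show ?thesis
    by (simp add: measure_le_0_iff)
qed

lemma measurable_transition [measurable]:
  assumes [simp]: "n \<ge> 1"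
  shows "{\<omega> \<in> space M. G n \<omega> = g \<and> G (n + 1) \<omega> = g'} \<in> sets M"
    and "{\<omega> \<in> space M. G n \<omega> = g} \<in> sets M"
proof -
  have *: "{\<omega> \<in> space M. G n \<omega> = g} \<in> sets M" if "n \<ge> 1" for n g
    using measurable_sets_Collect[OF random_graph[OF that], of "\<lambda>x. x = g"] by simp
  show "{\<omega> \<in> space M. G n \<omega> = g} \<in> sets M"
    by (rule *) (use assms in simp)
  show "{\<omega> \<in> space M. G n \<omega> = g \<and> G (n + 1) \<omega> = g'} \<in> sets M"
    using *[of n g] *[of "n + 1" g'] assms by (intro sets.sets_Collect_conj) auto
qed

lemma sum_prob_recursive:
  assumes n: "n \<ge> 1" and rec: "AE \<omega> in M. G n \<omega> \<in> recursive_graphs n"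
  shows "(\<Sum>g\<in>recursive_graphs n. \<P>(\<omega> in M. G n \<omega> = g)) = 1"
proof -
  have "(\<Sum>g\<in>recursive_graphs n. \<P>(\<omega> in M. G n \<omega> = g)) =
      prob (\<Union>g\<in>recursive_graphs n. {\<omega> \<in> space M. G n \<omega> = g})"
    using n by (intro finite_measure_finite_Union[symmetric])
      (auto simp: finite_recursive_graphs disjoint_family_on_def measurable_transition)
  also have "\<dots> = prob {\<omega> \<in> space M. G n \<omega> \<in> recursive_graphs n}"
    by (rule arg_cong[where f = prob]) auto
  also have "\<dots> = 1"
    using rec measurable_sets_Collect[OF random_graph[OF n], of "\<lambda>x. x \<in> recursive_graphs n"]
    by (subst prob_Collect_eq_1) auto
  finally show ?thesis .
qed

text \<open>The events indexed by \<open>(g, e)\<close> are finitely many and disjoint, and by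
  \<open>prob_step\<close> their probabilities already add up to 1, so they cover almost every
  outcome. The hypothesis on \<open>G n\<close> is the induction hypothesis of
  \<open>AE_recursive\<close>.\<close>

lemma AE_new_arc:
  assumes n: "n \<ge> 1" and rec: "AE \<omega> in M. G n \<omega> \<in> recursive_graphs n"
  shows "AE \<omega> in M. G n \<omega> \<in> recursive_graphs n \<and>
    (\<exists>e\<in>new_arcs n. G (n + 1) \<omega> = add_node_arc (G n \<omega>) (n + 1) e)"
proof -
  define A where "A = (\<lambda>(g, e). {\<omega> \<in> space M. G n \<omega> = g \<and> G (n + 1) \<omega> = add_node_arc g (n + 1) e})"
  let ?I = "recursive_graphs n \<times> new_arcs n"
  have disj: "disjoint_family_on A ?I"
    using inj_on_add_node_arc by (fastforce simp: disjoint_family_on_def A_def dest: inj_onD)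
  have sets: "A ` ?I \<subseteq> events"
    using n by (auto simp: A_def measurable_transition)
  have "prob (\<Union>x\<in>?I. A x) = (\<Sum>x\<in>?I. prob (A x))"
    using sets disj by (intro finite_measure_finite_Union) (auto simp: finite_recursive_graphs finite_new_arcs)
  also have "\<dots> = (\<Sum>g\<in>recursive_graphs n. \<Sum>e\<in>new_arcs n. \<P>(\<omega> in M. G n \<omega> = g) * arc_weight n g e)"
    unfolding sum.cartesian_product
    by (intro sum.cong refl) (auto simp: A_def prob_step[OF n, simplified])
  also have "\<dots> = 1"
    using sum_prob_recursive[OF n rec] n by (simp add: sum_distrib_left[symmetric] sum_arc_weight)
  finally have "AE \<omega> in M. \<omega> \<in> (\<Union>x\<in>?I. A x)"
    using sets finite_recursive_graphs finite_new_arcs by (subst prob_eq_1[symmetric]) auto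
  then show ?thesis
    by eventually_elim (auto simp: A_def)
qed

lemma AE_recursive: "n \<ge> 1 \<Longrightarrow> AE \<omega> in M. G n \<omega> \<in> recursive_graphs n"
proof (induction n rule: nat_induct_at_least)
  case base
  show ?case
    using start by eventually_elim (auto simp: loop_graph_def recursive_graphs_def)
next
  case (Suc n)
  from AE_new_arc[OF this] show ?case
    by eventually_elim (use add_node_arc_recursive in fastforce)
qed

text \<open>\<open>G n\<close> almost surely lies in a finite set, so any function of it is almost
  surely bounded.\<close>

lemma integrable_G_comp:
  assumes n: "n \<ge> 1"
  shows "integrable M (\<lambda>\<omega>. h (G n \<omega>) :: real)"
proof (rule integrable_const_bound)
  show "AE \<omega> in M. norm (h (G n \<omega>)) \<le> (\<Sum>g\<in>recursive_graphs n. \<bar>h g\<bar>)"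
    using AE_recursive[OF n]
    by eventually_elim (auto intro!: member_le_sum[where f = "\<lambda>g. \<bar>h g\<bar>"] simp: finite_recursive_graphs)
  show "(\<lambda>\<omega>. h (G n \<omega>)) \<in> borel_measurable M"
    using measurable_compose[OF random_graph[OF n], of h borel] by simp
qed

text \<open>The Markov property in integrated form. Splitting along the transition events
  \<open>A g e\<close> gives a finite sum to which \<open>prob_step\<close> applies; the sum over
  graphs is then folded back into an expectation.\<close>

lemma expectation_step:
  assumes n: "n \<ge> 1"
  shows "expectation (\<lambda>\<omega>. h (G (n + 1) \<omega>) :: real) =
    expectation (\<lambda>\<omega>. \<Sum>e\<in>new_arcs n. arc_weight n (G n \<omega>) e * h (add_node_arc (G n \<omega>) (n + 1) e))"
proof -
  define A where "A g e = {\<omega> \<in> space M. G n \<omega> = g \<and> G (n + 1) \<omega> = add_node_arc g (n + 1) e}" for g e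
  have [measurable]: "A g e \<in> events" for g e
    unfolding A_def using measurable_transition[OF n] by simp
  define B where "B g = {\<omega> \<in> space M. G n \<omega> = g}" for g
  have [measurable]: "B g \<in> events" for g
    unfolding B_def using measurable_transition[OF n] by simp
  have "AE \<omega> in M. h (G (n + 1) \<omega>) =
      (\<Sum>g\<in>recursive_graphs n. \<Sum>e\<in>new_arcs n. indicator (A g e) \<omega> * h (add_node_arc g (n + 1) e))"
    using AE_new_arc[OF n AE_recursive[OF n]] AE_space
  proof eventually_elim
    case (elim \<omega>)
    then obtain e where e: "e \<in> new_arcs n" "G (n + 1) \<omega> = add_node_arc (G n \<omega>) (n + 1) e"
      and g: "G n \<omega> \<in> recursive_graphs n"
      by auto
    \<comment> \<open>Only the pair formed by the current graph and the arc actually added survives;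
      injectivity rules out a second arc.\<close>
    have "(\<Sum>g\<in>recursive_graphs n. \<Sum>e'\<in>new_arcs n. indicator (A g e') \<omega> * h (add_node_arc g (n + 1) e')) =
        (\<Sum>g\<in>recursive_graphs n. \<Sum>e'\<in>new_arcs n.
          if g = G n \<omega> then (if e' = e then h (G (n + 1) \<omega>) else 0) else 0)"
      using elim e by (intro sum.cong refl)
        (auto simp: A_def indicator_def inj_on_eq_iff[OF inj_on_add_node_arc[OF g] e(1)])
    also have "\<dots> = (\<Sum>g\<in>recursive_graphs n. if g = G n \<omega> then h (G (n + 1) \<omega>) else 0)"
      using e(1) by (intro sum.cong refl) (simp add: finite_new_arcs)
    also have "\<dots> = h (G (n + 1) \<omega>)"
      using g by (simp add: finite_recursive_graphs)
    finally show ?case ..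
  qed
  then have "expectation (\<lambda>\<omega>. h (G (n + 1) \<omega>)) =
      expectation (\<lambda>\<omega>. \<Sum>g\<in>recursive_graphs n. \<Sum>e\<in>new_arcs n. indicator (A g e) \<omega> * h (add_node_arc g (n + 1) e))"
    using integrable_G_comp[of "n + 1" h] by (intro integral_cong_AE) (auto dest: borel_measurable_integrable)
  also have "\<dots> = (\<Sum>g\<in>recursive_graphs n. \<Sum>e\<in>new_arcs n. prob (A g e) * h (add_node_arc g (n + 1) e))"
    by (simp add: Bochner_Integration.integral_sum less_top[symmetric])
  also have "\<dots> = (\<Sum>g\<in>recursive_graphs n. prob (B g) * (\<Sum>e\<in>new_arcs n. arc_weight n g e * h (add_node_arc g (n + 1) e)))"
    unfolding A_def B_def sum_distrib_left
    by (intro sum.cong refl, subst prob_step[OF n]) auto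
  also have "\<dots> = expectation (\<lambda>\<omega>. \<Sum>g\<in>recursive_graphs n. indicator (B g) \<omega> *
      (\<Sum>e\<in>new_arcs n. arc_weight n g e * h (add_node_arc g (n + 1) e)))"
    by (subst Bochner_Integration.integral_sum) (auto simp: less_top[symmetric])
  also have "\<dots> = expectation (\<lambda>\<omega>. \<Sum>e\<in>new_arcs n. arc_weight n (G n \<omega>) e * h (add_node_arc (G n \<omega>) (n + 1) e))"
  proof (rule integral_cong_AE)
    show "AE \<omega> in M. (\<Sum>g\<in>recursive_graphs n. indicator (B g) \<omega> *
        (\<Sum>e\<in>new_arcs n. arc_weight n g e * h (add_node_arc g (n + 1) e))) =
      (\<Sum>e\<in>new_arcs n. arc_weight n (G n \<omega>) e * h (add_node_arc (G n \<omega>) (n + 1) e))"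
      using AE_recursive[OF n] AE_space
      by eventually_elim (simp add: B_def indicator_def if_distrib[where f = "\<lambda>x. x * _"]
          finite_recursive_graphs cong: if_cong)
    show "(\<lambda>\<omega>. \<Sum>e\<in>new_arcs n. arc_weight n (G n \<omega>) e * h (add_node_arc (G n \<omega>) (n + 1) e)) \<in> borel_measurable M"
      using integrable_G_comp[OF n, of "\<lambda>g. \<Sum>e\<in>new_arcs n. arc_weight n g e * h (add_node_arc g (n + 1) e)"]
      by auto
  qed measurable
  finally show ?thesis .
qed

end

section \<open>Vanishing of the normalised deviations\<close>

locale attachment_model_limit =
  attachment_model M \<alpha> \<gamma> \<delta>_in \<delta>_out G + limiting_frequencies \<alpha> \<gamma> \<delta>_in \<delta>_out p
  for M :: "'w measure" and \<alpha> \<gamma> \<delta>_in \<delta>_out G p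
begin

lemma expectation_deviation_step:
  assumes n: "n \<ge> 1"
  shows "expectation (\<lambda>\<omega>. (deviation (n + 1) i j (G (n + 1) \<omega>))\<^sup>2) \<le>
    expectation (\<lambda>\<omega>. (deviation n i j (G n \<omega>))\<^sup>2) +
    (2 * (rate_in i * expectation (\<lambda>\<omega>. \<bar>deviation n (i - 1) j (G n \<omega>)\<bar>)
        + rate_out j * expectation (\<lambda>\<omega>. \<bar>deviation n i (j - 1) (G n \<omega>)\<bar>)) + 9)"
proof -
  have [simp]: "integrable M (\<lambda>\<omega>. \<bar>deviation n k l (G n \<omega>)\<bar>)" "integrable M (\<lambda>\<omega>. (deviation n k l (G n \<omega>))\<^sup>2)" for k l
    using integrable_G_comp[OF n, of "\<lambda>g. \<bar>deviation n k l g\<bar>"]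
      integrable_G_comp[OF n, of "\<lambda>g. (deviation n k l g)\<^sup>2"] by simp_all
  have "expectation (\<lambda>\<omega>. (deviation (n + 1) i j (G (n + 1) \<omega>))\<^sup>2) =
      expectation (\<lambda>\<omega>. \<Sum>e\<in>new_arcs n. arc_weight n (G n \<omega>) e *
        (deviation (n + 1) i j (add_node_arc (G n \<omega>) (n + 1) e))\<^sup>2)"
    by (rule expectation_step[OF n])
  also have "\<dots> \<le> expectation (\<lambda>\<omega>. (deviation n i j (G n \<omega>))\<^sup>2 +
      2 * (rate_in i * \<bar>deviation n (i - 1) j (G n \<omega>)\<bar> + rate_out j * \<bar>deviation n i (j - 1) (G n \<omega>)\<bar>) + 9)"
    (is "_ \<le> expectation ?h")
  proof (rule integral_mono_AE)
    show "AE \<omega> in M. (\<Sum>e\<in>new_arcs n. arc_weight n (G n \<omega>) e *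
        (deviation (n + 1) i j (add_node_arc (G n \<omega>) (n + 1) e))\<^sup>2) \<le> ?h \<omega>"
      using AE_recursive[OF n] by eventually_elim (rule deviation_second_moment_step[OF _ n])
    show "integrable M (\<lambda>\<omega>. \<Sum>e\<in>new_arcs n. arc_weight n (G n \<omega>) e *
        (deviation (n + 1) i j (add_node_arc (G n \<omega>) (n + 1) e))\<^sup>2)"
      using integrable_G_comp[OF n, of "\<lambda>g. \<Sum>e\<in>new_arcs n. arc_weight n g e *
        (deviation (n + 1) i j (add_node_arc g (n + 1) e))\<^sup>2"] .
    show "integrable M ?h"
      using integrable_G_comp[OF n, of "\<lambda>g. (deviation n i j g)\<^sup>2 +
        2 * (rate_in i * \<bar>deviation n (i - 1) j g\<bar> + rate_out j * \<bar>deviation n i (j - 1) g\<bar>) + 9"] .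
  qed
  also have "\<dots> = expectation (\<lambda>\<omega>. (deviation n i j (G n \<omega>))\<^sup>2) +
    (2 * (rate_in i * expectation (\<lambda>\<omega>. \<bar>deviation n (i - 1) j (G n \<omega>)\<bar>)
        + rate_out j * expectation (\<lambda>\<omega>. \<bar>deviation n i (j - 1) (G n \<omega>)\<bar>)) + 9)"
    by (simp add: prob_space)
  finally show ?thesis .
qed

lemma expectation_deviation_tendsto_0:
  "(\<lambda>n. expectation (\<lambda>\<omega>. \<bar>deviation n i j (G n \<omega>)\<bar>) / real n) \<longlonglongrightarrow> 0"
proof (induction "i + j" arbitrary: i j rule: less_induct)
  case less
  define y where "y n = expectation (\<lambda>\<omega>. (deviation n i j (G n \<omega>))\<^sup>2)" for n
  define E where "E k l n = expectation (\<lambda>\<omega>. \<bar>deviation n k l (G n \<omega>)\<bar>)" for k l n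
  have "(\<lambda>n. rate_in i * (E (i - 1) j n / real n)) \<longlonglongrightarrow> 0"
  \<comment> \<open>At \<open>i = 0\<close> the truncated \<open>i - 1\<close> is no smaller index,
    so the vanishing rate has to replace the induction hypothesis.\<close>
  proof (cases i)
    case 0
    then show ?thesis by (simp add: rate_in_def)
  next
    case (Suc k)
    then show ?thesis
      using less[of "i - 1" j] by (auto simp: E_def simp del: times_divide_eq_right intro!: tendsto_mult_right_zero)
  qed
  moreover have "(\<lambda>n. rate_out j * (E i (j - 1) n / real n)) \<longlonglongrightarrow> 0"
  proof (cases j)
    case 0
    then show ?thesis by (simp add: rate_out_def)
  next
    case (Suc k)
    then show ?thesis
      using less[of i "j - 1"] by (auto simp: E_def simp del: times_divide_eq_right intro!: tendsto_mult_right_zero)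
  qed
  moreover have "(\<lambda>n. 9 / real n) \<longlonglongrightarrow> 0"
    by real_asymp
  ultimately have "(\<lambda>n. 2 * (rate_in i * (E (i - 1) j n / real n) + rate_out j * (E i (j - 1) n / real n)) + 9 / real n)
      \<longlonglongrightarrow> 2 * (0 + 0) + 0"
    by (intro tendsto_intros)
  then have "(\<lambda>n. (2 * (rate_in i * E (i - 1) j n + rate_out j * E i (j - 1) n) + 9) / real n) \<longlonglongrightarrow> 0"
    by (simp add: add_divide_distrib)
  moreover have "y (Suc n) \<le> y n + (2 * (rate_in i * E (i - 1) j n + rate_out j * E i (j - 1) n) + 9)" if "n \<ge> 1" for n
    using expectation_deviation_step[OF that, of i j] by (simp add: y_def E_def)
  ultimately have "(\<lambda>n. y n / (real n)\<^sup>2) \<longlonglongrightarrow> 0"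
    by (intro quadratic_growth_of_increments) (auto simp: y_def)
  then have lim: "(\<lambda>n. sqrt (y n / (real n)\<^sup>2)) \<longlonglongrightarrow> 0"
    using tendsto_real_sqrt by fastforce
  show ?case
  proof (rule tendsto_sandwich[OF _ _ tendsto_const lim])
    show "\<forall>\<^sub>F n in sequentially. expectation (\<lambda>\<omega>. \<bar>deviation n i j (G n \<omega>)\<bar>) / real n \<le> sqrt (y n / (real n)\<^sup>2)"
      using eventually_ge_at_top[of 1]
    proof eventually_elim
      case (elim n)
      \<comment> \<open>Nonnegativity of a variance supplies the Cauchy-Schwarz inequality that
        leads from second moments back to first ones.\<close>
      have "variance (\<lambda>\<omega>. \<bar>deviation n i j (G n \<omega>)\<bar>) = y n - (E i j n)\<^sup>2"
        using integrable_G_comp[OF elim, of "\<lambda>g. \<bar>deviation n i j g\<bar>"]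
          integrable_G_comp[OF elim, of "\<lambda>g. (deviation n i j g)\<^sup>2"]
        by (subst variance_eq) (auto simp: y_def E_def)
      moreover have "variance (\<lambda>\<omega>. \<bar>deviation n i j (G n \<omega>)\<bar>) \<ge> 0"
        by (rule variance_positive)
      ultimately have "E i j n \<le> sqrt (y n)"
        by (intro real_le_rsqrt) simp
      then show ?case
        by (simp add: E_def real_sqrt_divide divide_right_mono)
    qed
    show "\<forall>\<^sub>F n in sequentially. 0 \<le> expectation (\<lambda>\<omega>. \<bar>deviation n i j (G n \<omega>)\<bar>) / real n"
      by (intro always_eventually allI divide_nonneg_nonneg integral_nonneg) auto
  qed
qed

text \<open>Markov's inequality for the absolute deviation, whose mean is o(n).\<close>

lemma node_count_tendsto_in_prob:
  "tendsto_in_prob M (\<lambda>n \<omega>. real (node_count i j (G n \<omega>)) / real n) (p i j)"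
  unfolding tendsto_in_prob_def
proof (intro allI impI)
  fix \<epsilon> :: real assume \<epsilon>: "\<epsilon> > 0"
  let ?E = "\<lambda>n. expectation (\<lambda>\<omega>. \<bar>deviation n i j (G n \<omega>)\<bar>) / real n"
  have lim: "(\<lambda>n. ?E n / \<epsilon>) \<longlonglongrightarrow> 0"
    using tendsto_divide[OF expectation_deviation_tendsto_0 tendsto_const[of \<epsilon>]] \<epsilon> by simp
  show "(\<lambda>n. \<P>(\<omega> in M. \<bar>real (node_count i j (G n \<omega>)) / real n - p i j\<bar> > \<epsilon>)) \<longlonglongrightarrow> 0"
  proof (rule tendsto_sandwich[OF _ _ tendsto_const lim])
    show "\<forall>\<^sub>F n in sequentially. \<P>(\<omega> in M. \<bar>real (node_count i j (G n \<omega>)) / real n - p i j\<bar> > \<epsilon>) \<le> ?E n / \<epsilon>"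
      using eventually_ge_at_top[of 1]
    proof eventually_elim
      case (elim n)
      have "real (node_count i j g) / real n - p i j = deviation n i j g / real n" for g
        using elim by (simp add: deviation_def diff_divide_distrib)
      then have eq: "\<bar>real (node_count i j g) / real n - p i j\<bar> > \<epsilon> \<longleftrightarrow> \<bar>deviation n i j g\<bar> > \<epsilon> * real n" for g
        using elim by (simp add: field_simps)
      have [measurable]: "(\<lambda>\<omega>. deviation n i j (G n \<omega>)) \<in> borel_measurable M"
        using integrable_G_comp[OF elim] by auto
      have "\<P>(\<omega> in M. \<bar>deviation n i j (G n \<omega>)\<bar> > \<epsilon> * real n) \<le> \<P>(\<omega> in M. \<bar>deviation n i j (G n \<omega>)\<bar> \<ge> \<epsilon> * real n)"
        by (intro finite_measure_mono) auto
      also have "\<dots> \<le> expectation (\<lambda>\<omega>. \<bar>deviation n i j (G n \<omega>)\<bar>) / (\<epsilon> * real n)"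
        using elim \<epsilon> by (intro integral_Markov_inequality_measure[where A = "space M"] integrable_G_comp) auto
      finally show ?case
        unfolding eq by (simp add: mult.commute)
    qed
  qed simp
qed

end

section \<open>Negative binomial laws and linear birth processes\<close>

text \<open>The usual coefficient \<open>a + k - 1\<close> choose \<open>k\<close> is written with a
  rising factorial, which makes sense for real \<open>a\<close>.\<close>

definition nb_weight :: "real \<Rightarrow> real \<Rightarrow> nat \<Rightarrow> real" where
  "nb_weight a p k = pochhammer a k / fact k * p powr a * (1 - p) ^ k"

lemma nb_weight_nonneg: "a > 0 \<Longrightarrow> p \<le> 1 \<Longrightarrow> nb_weight a p k \<ge> 0"
  by (auto simp: nb_weight_def intro!: mult_nonneg_nonneg divide_nonneg_pos pochhammer_nonneg)

text \<open>Newton's binomial series with exponent \<open>- a\<close> at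
  \<open>- ((1 - p) * s)\<close>, whose signs cancel against those of \<open>- a gchoose k\<close>.
  The case \<open>s = 1\<close> gives total mass 1.\<close>

lemma nb_weight_sums:
  assumes "0 < p" "p < 1" "0 \<le> s" "s \<le> 1"
  shows "(\<lambda>k. nb_weight a p k * s ^ k) sums (p powr a * (1 - (1 - p) * s) powr (- a))"
proof -
  have "(1 - p) * s \<le> 1 - p"
    using assms by (intro mult_left_le) auto
  then have "(1 - p) * s < 1"
    using assms by linarith
  then have "\<bar>- ((1 - p) * s)\<bar> < 1"
    using assms by simp
  from sums_mult[OF gen_binomial_real[OF this, of "- a"], of "p powr a"]
  have "(\<lambda>k. p powr a * ((- a gchoose k) * (- ((1 - p) * s)) ^ k)) sums (p powr a * (1 - (1 - p) * s) powr (- a))"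
    by simp
  moreover have "p powr a * ((- a gchoose k) * (- ((1 - p) * s)) ^ k) = nb_weight a p k * s ^ k" for k
  proof -
    have "(- ((1 - p) * s)) ^ k = (-1) ^ k * ((1 - p) ^ k * s ^ k)"
      by (metis mult_minus1 power_mult_distrib)
    moreover have "(-1) ^ k * ((-1) ^ k * x) = x" for x :: real
      by (metis left_minus_one_mult_self)
    ultimately show ?thesis
      by (simp add: gbinomial_pochhammer nb_weight_def mult_ac)
  qed
  ultimately show ?thesis
    by simp
qed

text \<open>Fixing a value outside \<open>(0, 1)\<close> keeps the law explicit at all times, also
  for \<open>t \<le> 0\<close>, where \<open>exp (- c * t)\<close> leaves that interval.\<close>

definition nb_pmf :: "real \<Rightarrow> real \<Rightarrow> nat pmf" where
  "nb_pmf a p = (if 0 < p \<and> p < 1 then embed_pmf (nb_weight a p) else return_pmf 0)"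

lemma pmf_nb_pmf:
  assumes "a > 0" "0 < p" "p < 1"
  shows "pmf (nb_pmf a p) k = nb_weight a p k"
proof -
  have "(\<lambda>k. nb_weight a p k) sums 1"
    using nb_weight_sums[of p 1 a] assms by (simp flip: powr_add)
  then have "(\<integral>\<^sup>+ k. ennreal (nb_weight a p k) \<partial>count_space UNIV) = 1"
    using assms by (simp add: nn_integral_count_space_nat suminf_ennreal_eq[where x = 1] nb_weight_nonneg sums_iff)
  then show ?thesis
    using assms by (simp add: nb_pmf_def pmf_embed_pmf nb_weight_nonneg)
qed

lemma is_neg_binomial_nb_pmf:
  assumes "a > 0" "0 < p" "p < 1"
  shows "is_neg_binomial a p (nb_pmf a p)"
  unfolding is_neg_binomial_def
proof
  fix s :: real assume s: "s \<in> {0..1}"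
  have sums: "(\<lambda>k. nb_weight a p k * s ^ k) sums (p powr a * (1 - (1 - p) * s) powr (- a))"
    using nb_weight_sums assms s by simp
  have "measure_pmf.expectation (nb_pmf a p) (\<lambda>k. s ^ k) = (\<integral>k. nb_weight a p k * s ^ k \<partial>count_space UNIV)"
    unfolding measure_pmf_eq_density using assms
    by (subst integral_density) (simp_all add: pmf_nb_pmf nb_weight_nonneg)
  also have "\<dots> = (\<Sum>k. nb_weight a p k * s ^ k)"
    using sums s assms by (intro integral_count_space_nat)
      (auto simp: integrable_count_space_nat_iff abs_mult nb_weight_nonneg sums_iff)
  finally show "measure_pmf.expectation (nb_pmf a p) (\<lambda>k. s ^ k) = p powr a * (1 - (1 - p) * s) powr (- a)"
    using sums by (simp add: sums_iff)
qed

text \<open>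
  The transition function at time \<open>t\<close> of the pure birth process that starts in \<open>0\<close> and jumps from
  \<open>k\<close> to \<open>k + 1\<close> at rate \<open>c (k + a)\<close>.
\<close>

definition birth_prob :: "real \<Rightarrow> real \<Rightarrow> nat \<Rightarrow> real \<Rightarrow> real" where
  "birth_prob a c k t = pochhammer a k / fact k * exp (- (c * a * t)) * (1 - exp (- (c * t))) ^ k"

text \<open>At the parameter \<open>exp (- c * t)\<close> the factor \<open>p powr a\<close> becomes
  \<open>exp (- (c * a * t))\<close>. This identifies the families of the theorem with the birth
  process.\<close>

lemma pmf_nb_pmf_exp:
  assumes "a > 0" "c > 0" "t > 0"
  shows "pmf (nb_pmf a (exp (- c * t))) k = birth_prob a c k t"
  using assms by (subst pmf_nb_pmf) (auto simp: nb_weight_def birth_prob_def powr_def mult_ac)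

lemma birth_prob_0: "birth_prob a c k 0 = of_bool (k = 0)"
  by (simp add: birth_prob_def power_0_left)

lemma birth_prob_bounds:
  assumes "a > 0" "c > 0" "t \<ge> 0"
  shows "0 \<le> birth_prob a c k t" "birth_prob a c k t \<le> 1"
proof -
  consider "t = 0" | "t > 0" using assms by linarith
  then have "0 \<le> birth_prob a c k t \<and> birth_prob a c k t \<le> 1"
  proof cases
    case 1
    then show ?thesis by (simp add: birth_prob_0)
  next
    case 2
    then show ?thesis
      using assms by (simp add: pmf_le_1 flip: pmf_nb_pmf_exp)
  qed
  then show "0 \<le> birth_prob a c k t" "birth_prob a c k t \<le> 1" by auto
qed

text \<open>Kolmogorov's forward equation, verified by differentiating the closed form.\<close>

lemma birth_prob_deriv:
  "(birth_prob a c k has_real_derivative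
     attach_rate c a k * birth_prob a c (k - 1) t - attach_rate c a (Suc k) * birth_prob a c k t) (at t)"
proof (cases k)
  case 0
  show ?thesis
    unfolding birth_prob_def[abs_def] 0
    by (auto intro!: derivative_eq_intros)
next
  case (Suc m)
  define e where "e = exp (- (c * t))"
  define E where "E = exp (- (c * a * t))"
  define P where "P = pochhammer a m / fact m"
  have P: "pochhammer a (Suc m) / fact (Suc m) = P * (a + real m) / (1 + real m)"
    by (simp add: P_def pochhammer_Suc field_simps)
  have D1: "((\<lambda>t. (1 - exp (- (c * t))) ^ Suc m) has_real_derivative (1 + real m) * (c * e * (1 - e) ^ m)) (at t)"
    unfolding e_def by (intro DERIV_power_Suc) (auto intro!: derivative_eq_intros)
  have D2: "((\<lambda>t. exp (- (c * a * t))) has_real_derivative - (c * a) * E) (at t)"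
    unfolding E_def by (auto intro!: derivative_eq_intros)
  have "(birth_prob a c k has_real_derivative
      P * (a + real m) / (1 + real m) * (- (c * a) * E * (1 - e) ^ Suc m + (1 + real m) * (c * e * (1 - e) ^ m) * E)) (at t)"
    using DERIV_cmult[OF DERIV_mult[OF D2 D1], of "P * (a + real m) / (1 + real m)"]
    unfolding birth_prob_def[abs_def] Suc P by (simp only: e_def E_def mult.assoc)
  \<comment> \<open>Writing \<open>e\<close> as \<open>1 - (1 - e)\<close> splits the second
    product: one part is the gain from state \<open>m\<close>, the other has the power
    \<open>(1 - e) ^ Suc m\<close> and combines with the first product to the loss.\<close>
  also have "P * (a + real m) / (1 + real m) * (- (c * a) * E * (1 - e) ^ Suc m + (1 + real m) * (c * e * (1 - e) ^ m) * E) =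
      c * (real m + a) * (P * E * (1 - e) ^ m) - c * (real (Suc m) + a) * (P * (a + real m) / (1 + real m) * E * (1 - e) ^ Suc m)"
    by (simp add: field_simps)
  also have "\<dots> = attach_rate c a k * birth_prob a c (k - 1) t - attach_rate c a (Suc k) * birth_prob a c k t"
    unfolding birth_prob_def Suc by (subst P) (simp add: e_def E_def P_def)
  finally show ?thesis .
qed

text \<open>
  The same jump rates, but started in \<open>1\<close>: the total degree of the chosen direction of a node that
  is born with one arc in that direction.
\<close>

definition birth_prob_from_1 :: "real \<Rightarrow> real \<Rightarrow> nat \<Rightarrow> real \<Rightarrow> real" where
  "birth_prob_from_1 a c k t = (if k = 0 then 0 else birth_prob (1 + a) c (k - 1) t)"

lemma birth_prob_from_1_0: "birth_prob_from_1 a c k 0 = of_bool (k = 1)"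
  by (auto simp: birth_prob_from_1_def birth_prob_0)

lemma birth_prob_from_1_bounds:
  assumes "a > 0" "c > 0" "t \<ge> 0"
  shows "0 \<le> birth_prob_from_1 a c k t" "birth_prob_from_1 a c k t \<le> 1"
  using birth_prob_bounds[of "1 + a" c t] assms by (auto simp: birth_prob_from_1_def)

lemma birth_prob_from_1_deriv:
  "(birth_prob_from_1 a c k has_real_derivative
     attach_rate c a k * birth_prob_from_1 a c (k - 1) t - attach_rate c a (Suc k) * birth_prob_from_1 a c k t) (at t)"
proof (cases k)
  case 0
  then show ?thesis by (simp add: birth_prob_from_1_def[abs_def])
next
  case (Suc m)
  have "(birth_prob (1 + a) c m has_real_derivative
     attach_rate c (1 + a) m * birth_prob (1 + a) c (m - 1) t - attach_rate c (1 + a) (Suc m) * birth_prob (1 + a) c m t) (at t)"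
    by (rule birth_prob_deriv)
  then show ?thesis
    \<comment> \<open>The rates with parameter \<open>1 + a\<close> are those with parameter
      \<open>a\<close> shifted by one state, except that \<open>attach_rate c (1 + a) 0\<close> is 0
      while \<open>attach_rate c a 1\<close> is \<open>c * a\<close>. That rate is multiplied by
      \<open>birth_prob_from_1\<close> at state 0, which is 0; hence the split on
      \<open>m\<close>.\<close>
    unfolding Suc by (cases m) (auto simp: birth_prob_from_1_def[abs_def] algebra_simps)
qed

section \<open>Expectations under the exponential law\<close>

definition exp_law :: "real measure" where
  "exp_law = density lborel (exponential_density 1)"

lemma prob_space_exp_law: "prob_space exp_law"
  unfolding exp_law_def by (rule prob_space_exponential_density) simp

lemma space_exp_law [simp]: "space exp_law = UNIV"
  and sets_exp_law [simp, measurable_cong]: "sets exp_law = sets borel"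
  by (simp_all add: exp_law_def)

lemma AE_exp_law_pos: "AE t in exp_law. t > 0"
proof -
  have "AE t in lborel. t \<noteq> (0::real)"
    by (rule AE_lborel_singleton)
  then have "AE t in lborel. 0 < ennreal (exponential_density 1 t) \<longrightarrow> t > 0"
    by eventually_elim (auto simp: exponential_density_def)
  then show ?thesis
    unfolding exp_law_def by (subst AE_density) auto
qed

lemma integrable_exp_law:
  assumes "f \<in> borel_measurable borel" "\<And>t. t > 0 \<Longrightarrow> \<bar>f t :: real\<bar> \<le> B"
  shows "integrable exp_law f"
proof -
  interpret prob_space exp_law by (rule prob_space_exp_law)
  show ?thesis
    using AE_exp_law_pos assms(1)
    by (intro integrable_const_bound[where B = B]) (auto elim!: eventually_mono dest: assms(2))
qed

text \<open>Integration by parts: \<open>exp (- t) * u t\<close> has derivative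
  \<open>exp (- t) * (u' t - u t)\<close>, tends to 0 at infinity because \<open>u\<close> is
  bounded, and equals \<open>u 0\<close> at 0. The two bounds also give integrability.\<close>

lemma integral_exp_law_deriv:
  fixes u u' :: "real \<Rightarrow> real"
  assumes u: "\<And>t. (u has_real_derivative u' t) (at t)" and cont: "continuous_on UNIV u'"
    and bound: "\<And>t. t \<ge> 0 \<Longrightarrow> \<bar>u t\<bar> \<le> B" "\<And>t. t \<ge> 0 \<Longrightarrow> \<bar>u' t\<bar> \<le> B'"
  shows "(\<integral>t. u t \<partial>exp_law) = u 0 + (\<integral>t. u' t \<partial>exp_law)"
proof -
  define f where "f t = exp (- t) * (u' t - u t)" for t
  have cont_u: "continuous_on UNIV u"
    using u by (meson DERIV_isCont continuous_at_imp_continuous_on)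
  have [measurable]: "u \<in> borel_measurable borel" "u' \<in> borel_measurable borel"
    using cont cont_u by (auto intro: borel_measurable_continuous_onI)
  have int: "integrable exp_law u" "integrable exp_law u'"
    using integrable_exp_law[of u B] integrable_exp_law[of u' B'] bound by auto
  then have "integrable exp_law (\<lambda>t. u' t - u t)"
    by auto
  then have int': "integrable lborel (\<lambda>t. exponential_density 1 t * (u' t - u t))"
    unfolding exp_law_def by (subst (asm) integrable_density) auto
  have [measurable]: "f \<in> borel_measurable borel"
    unfolding f_def by measurable
  \<comment> \<open>The open interval leaves out 0, where the density is 1; the integrands can
    differ only there.\<close>
  have AE: "AE t in lborel. indicator (einterval 0 \<infinity>) t * f t = exponential_density 1 t * (u' t - u t)"
    using AE_lborel_singleton[of "0::real"]
    by eventually_elim (auto simp: f_def exponential_density_def indicator_def einterval_def)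
  have "(LBINT x=ereal 0..\<infinity>. f x) = 0 - (- 0 + u 0)"
  proof (rule interval_integral_FTC_integrable[where F = "\<lambda>t. exp (- t) * u t"])
    show "((\<lambda>t. exp (- t) * u t) has_vector_derivative f x) (at x)" for x
      unfolding has_real_derivative_iff_has_vector_derivative[symmetric] f_def
      by (auto intro!: derivative_eq_intros u simp: algebra_simps)
    show "isCont f x" for x
      using cont cont_u unfolding f_def by (intro continuous_intros) (auto simp: continuous_on_eq_continuous_at)
    show "set_integrable lborel (einterval (ereal 0) \<infinity>) f"
      using integrable_cong_AE_imp[OF int' _ AE_symmetric[OF AE]] by (simp add: set_integrable_def zero_ereal_def)
    have "((\<lambda>t. exp (- t) * u t) \<longlongrightarrow> exp (- 0) * u 0) (at_right 0)"
      using DERIV_isCont[OF u, of 0] by (intro tendsto_intros) (simp add: isCont_def filterlim_at_split)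
    then show "(((\<lambda>t. exp (- t) * u t) \<circ> real_of_ereal) \<longlongrightarrow> - 0 + u 0) (at_right (ereal 0))"
      by (subst ereal_tendsto_simps) simp
    have "((\<lambda>t. exp (- t) * u t) \<longlongrightarrow> 0) at_top"
    proof (rule Lim_null_comparison)
      show "\<forall>\<^sub>F t in at_top. norm (exp (- t) * u t) \<le> exp (- t) * B"
        using eventually_ge_at_top[of 0] by eventually_elim (auto simp: abs_mult bound)
      show "((\<lambda>t. exp (- t) * B) \<longlongrightarrow> 0) at_top"
        by real_asymp
    qed
    then show "(((\<lambda>t. exp (- t) * u t) \<circ> real_of_ereal) \<longlongrightarrow> 0) (at_left \<infinity>)"
      by (subst ereal_tendsto_simps) simp
  qed auto
  then have "(\<integral>t. indicator (einterval 0 \<infinity>) t * f t \<partial>lborel) = - u 0"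
    by (simp add: interval_lebesgue_integral_def set_lebesgue_integral_def zero_ereal_def)
  moreover have "(\<integral>t. u' t - u t \<partial>exp_law) = (\<integral>t. indicator (einterval 0 \<infinity>) t * f t \<partial>lborel)"
    unfolding exp_law_def using AE
    by (subst integral_density) (auto intro!: integral_cong_AE elim: AE_symmetric)
  ultimately show ?thesis
    using int by simp
qed

section \<open>Solution of the stationary recursion\<close>

context attachment_parameters
begin

text \<open>The degree law of a node of logarithmic age \<open>t\<close>. The node is born with an
  outgoing arc (weight \<open>\<alpha>\<close>) or an incoming one (weight \<open>\<gamma>\<close>);
  that direction starts from 1, the other from 0.\<close>

definition degree_prob :: "nat \<Rightarrow> nat \<Rightarrow> real \<Rightarrow> real" where
  "degree_prob i j t =
     \<alpha> * (birth_prob \<delta>_in c_in i t * birth_prob_from_1 \<delta>_out c_out j t) +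
     \<gamma> * (birth_prob_from_1 \<delta>_in c_in i t * birth_prob \<delta>_out c_out j t)"

definition limit_prob :: "nat \<Rightarrow> nat \<Rightarrow> real" where
  "limit_prob i j = (\<integral>t. degree_prob i j t \<partial>exp_law)"

lemma degree_prob_0: "degree_prob i j 0 = arc_source i j"
  by (auto simp: degree_prob_def birth_prob_0 birth_prob_from_1_0 arc_source_def)

text \<open>The product rule combines the forward equations of the two coordinates. Both summands
  obey the same linear equation, since the starting state does not affect the rates, and so does
  their mixture.\<close>

lemma degree_prob_deriv:
  "(degree_prob i j has_real_derivative
     rate_in i * degree_prob (i - 1) j t + rate_out j * degree_prob i (j - 1) t
      - (rate_in (Suc i) + rate_out (Suc j)) * degree_prob i j t) (at t)"
  unfolding degree_prob_def[abs_def]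
  by (rule derivative_eq_intros birth_prob_deriv birth_prob_from_1_deriv refl)+
    (simp add: rate_in_def rate_out_def algebra_simps)

lemma degree_prob_bounds:
  assumes "t \<ge> 0"
  shows "0 \<le> degree_prob i j t" "degree_prob i j t \<le> 1"
proof -
  note b = birth_prob_bounds[OF delta(1) c_pos(1) assms] birth_prob_bounds[OF delta(2) c_pos(2) assms]
    birth_prob_from_1_bounds[OF delta(1) c_pos(1) assms] birth_prob_from_1_bounds[OF delta(2) c_pos(2) assms]
  show "0 \<le> degree_prob i j t"
    unfolding degree_prob_def using alpha gamma_pos b
    by (intro add_nonneg_nonneg mult_nonneg_nonneg) auto
  have "degree_prob i j t \<le> \<alpha> * 1 + \<gamma> * 1"
    unfolding degree_prob_def using alpha gamma_pos b
    by (intro add_mono mult_left_mono mult_le_one) auto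
  then show "degree_prob i j t \<le> 1"
    by (simp add: gamma)
qed

lemma continuous_degree_prob: "continuous_on S (degree_prob i j)"
  using degree_prob_deriv by (meson DERIV_isCont continuous_at_imp_continuous_on)

lemma borel_measurable_degree_prob [measurable]: "degree_prob i j \<in> borel_measurable borel"
  by (intro borel_measurable_continuous_onI continuous_degree_prob)

lemma integrable_degree_prob [simp]: "integrable exp_law (degree_prob i j)"
  using degree_prob_bounds by (intro integrable_exp_law[where B = 1]) (auto simp: abs_le_iff intro: order_trans[of _ 0])

text \<open>\<open>integral_exp_law_deriv\<close> is applied to the forward equation: the initial
  value is \<open>arc_source i j\<close>, and the loss term moved to the left joins the
  \<open>1\<close> in the factor.\<close>

lemma limit_prob_recursion:
  "(1 + rate_in (Suc i) + rate_out (Suc j)) * limit_prob i j =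
      rate_in i * limit_prob (i - 1) j + rate_out j * limit_prob i (j - 1) + arc_source i j"
proof -
  have "limit_prob i j = degree_prob i j 0 +
      (\<integral>t. rate_in i * degree_prob (i - 1) j t + rate_out j * degree_prob i (j - 1) t
        - (rate_in (Suc i) + rate_out (Suc j)) * degree_prob i j t \<partial>exp_law)"
    unfolding limit_prob_def
  proof (rule integral_exp_law_deriv[OF degree_prob_deriv])
    show "\<bar>degree_prob i j t\<bar> \<le> 1" if "t \<ge> 0" for t
      using degree_prob_bounds[OF that, of i j] by simp
    show "\<bar>rate_in i * degree_prob (i - 1) j t + rate_out j * degree_prob i (j - 1) t
        - (rate_in (Suc i) + rate_out (Suc j)) * degree_prob i j t\<bar>
      \<le> rate_in i * 1 + rate_out j * 1 + (rate_in (Suc i) + rate_out (Suc j)) * 1" if "t \<ge> 0" for t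
      using rate_nonneg degree_prob_bounds[OF that]
      by (intro abs_triangle_ineq4[THEN order_trans] add_mono abs_triangle_ineq[THEN order_trans])
        (auto simp: abs_mult intro!: mult_left_mono mult_left_le)
    show "continuous_on UNIV (\<lambda>t. rate_in i * degree_prob (i - 1) j t + rate_out j * degree_prob i (j - 1) t
        - (rate_in (Suc i) + rate_out (Suc j)) * degree_prob i j t)"
      by (intro continuous_intros continuous_degree_prob)
  qed
  then show ?thesis
    by (simp add: degree_prob_0 limit_prob_def algebra_simps)
qed

lemma limit_prob_bounds: "0 \<le> limit_prob i j" "limit_prob i j \<le> 1"
proof -
  interpret E: prob_space exp_law by (rule prob_space_exp_law)
  have AE: "AE t in exp_law. 0 \<le> degree_prob i j t \<and> degree_prob i j t \<le> 1"
    using AE_exp_law_pos by eventually_elim (use degree_prob_bounds in auto)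
  show "0 \<le> limit_prob i j"
    unfolding limit_prob_def using AE by (intro integral_nonneg_AE) auto
  have "limit_prob i j \<le> (\<integral>t. 1 \<partial>exp_law)"
    unfolding limit_prob_def using AE by (intro integral_mono_AE) auto
  then show "limit_prob i j \<le> 1"
    using E.prob_space by simp
qed

lemma limiting_frequencies_limit_prob: "limiting_frequencies \<alpha> \<gamma> \<delta>_in \<delta>_out limit_prob"
  by unfold_locales (rule limit_prob_bounds limit_prob_recursion)+

end

section \<open>Mixtures of countable laws\<close>

text \<open>The joint law of \<open>t\<close> drawn from \<open>E\<close> and a value drawn from
  \<open>K t\<close>. Since the values are countable, a density with respect to a counting measure
  can express it.\<close>

definition mixture_measure :: "'a measure \<Rightarrow> ('a \<Rightarrow> 'b::countable pmf) \<Rightarrow> ('a \<times> 'b) measure" where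
  "mixture_measure E K = density (E \<Otimes>\<^sub>M count_space UNIV) (\<lambda>(t, z). ennreal (pmf (K t) z))"

locale mixture_kernel = prob_space E for E :: "'a measure" +
  fixes K :: "'a \<Rightarrow> 'b::countable pmf"
  assumes measurable_pmf [measurable]: "\<And>z. (\<lambda>t. pmf (K t) z) \<in> borel_measurable E"
begin

text \<open>Countably many measurable slices can be glued, so joint measurability follows from the
  pointwise condition on the kernel.\<close>

lemma measurable_countable_section:
  assumes "\<And>z. (\<lambda>t. h (t, z)) \<in> borel_measurable E"
  shows "h \<in> borel_measurable (E \<Otimes>\<^sub>M count_space (UNIV :: 'b set))"
proof -
  have "(\<lambda>w. (\<lambda>z w. h (fst w, z)) (snd w) w) \<in> borel_measurable (E \<Otimes>\<^sub>M count_space (UNIV :: 'b set))"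
    by (rule measurable_compose_countable'[where I = UNIV])
      (auto intro: measurable_compose[OF measurable_fst assms])
  then show ?thesis by simp
qed

lemma space_mixture_measure [simp]: "space (mixture_measure E K) = space E \<times> UNIV"
  by (simp add: mixture_measure_def space_pair_measure)

lemma sets_mixture_measure [simp, measurable_cong]:
  "sets (mixture_measure E K) = sets (E \<Otimes>\<^sub>M count_space UNIV)"
  by (simp add: mixture_measure_def)

lemma borel_measurable_emeasure_section [measurable]:
  "(\<lambda>t. emeasure (K t) {z. P t z}) \<in> borel_measurable E"
  if [measurable]: "\<And>z. Measurable.pred E (\<lambda>t. P t z)"
proof -
  interpret C: sigma_finite_measure "count_space (UNIV :: 'b set)"
    by (rule sigma_finite_measure_count_space_countable) simp
  have "emeasure (K t) {z. P t z} = (\<integral>\<^sup>+z. ennreal (pmf (K t) z) * indicator {z. P t z} z \<partial>count_space UNIV)" for t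
    by (simp add: nn_integral_measure_pmf flip: nn_integral_indicator)
  moreover have "(\<lambda>t. \<integral>\<^sup>+z. (\<lambda>(t, z). ennreal (pmf (K t) z) * indicator {z. P t z} z) (t, z) \<partial>count_space UNIV) \<in> borel_measurable E"
    by (intro C.borel_measurable_nn_integral_fst measurable_countable_section) (simp add: indicator_def)
  ultimately show ?thesis by simp
qed

text \<open>Tonelli's theorem; the inner integral over the counting measure is the
  \<open>K t\<close>-measure of the section.\<close>

lemma emeasure_mixture_measure:
  assumes A: "A \<in> sets (E \<Otimes>\<^sub>M count_space UNIV)"
  shows "emeasure (mixture_measure E K) A = (\<integral>\<^sup>+t. emeasure (K t) {z. (t, z) \<in> A} \<partial>E)"
proof -
  interpret C: sigma_finite_measure "count_space (UNIV :: 'b set)"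
    by (rule sigma_finite_measure_count_space_countable) simp
  have [measurable]: "(\<lambda>(t, z). ennreal (pmf (K t) z)) \<in> borel_measurable (E \<Otimes>\<^sub>M count_space UNIV)"
    by (rule measurable_countable_section) simp
  have "emeasure (mixture_measure E K) A =
      (\<integral>\<^sup>+w. (\<lambda>(t, z). ennreal (pmf (K t) z)) w * indicator A w \<partial>(E \<Otimes>\<^sub>M count_space UNIV))"
    unfolding mixture_measure_def using A by (subst emeasure_density) auto
  also have "\<dots> = (\<integral>\<^sup>+t. \<integral>\<^sup>+z. ennreal (pmf (K t) z) * indicator A (t, z) \<partial>count_space UNIV \<partial>E)"
    using A by (subst C.nn_integral_fst[symmetric]) auto
  also have "\<dots> = (\<integral>\<^sup>+t. emeasure (K t) {z. (t, z) \<in> A} \<partial>E)"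
  proof (rule nn_integral_cong)
    fix t
    have "emeasure (K t) {z. (t, z) \<in> A} = (\<integral>\<^sup>+z. indicator {z. (t, z) \<in> A} z \<partial>K t)"
      by simp
    also have "\<dots> = (\<integral>\<^sup>+z. ennreal (pmf (K t) z) * indicator A (t, z) \<partial>count_space UNIV)"
      by (subst nn_integral_measure_pmf) (simp add: indicator_def)
    finally show "(\<integral>\<^sup>+z. ennreal (pmf (K t) z) * indicator A (t, z) \<partial>count_space UNIV) = emeasure (K t) {z. (t, z) \<in> A}" ..
  qed
  finally show ?thesis .
qed

lemma prob_space_mixture_measure: "prob_space (mixture_measure E K)"
proof
  have "emeasure (mixture_measure E K) (space E \<times> UNIV) = (\<integral>\<^sup>+t. emeasure (K t) {z. (t, z) \<in> space E \<times> UNIV} \<partial>E)"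
    by (rule emeasure_mixture_measure) auto
  also have "\<dots> = (\<integral>\<^sup>+t. 1 \<partial>E)"
    by (intro nn_integral_cong) (simp add: measure_pmf.emeasure_space_1[simplified])
  finally show "emeasure (mixture_measure E K) (space (mixture_measure E K)) = 1"
    by (simp add: emeasure_space_1)
qed

lemma measure_mixture_measure:
  assumes A: "A \<in> sets (E \<Otimes>\<^sub>M count_space UNIV)"
  shows "measure (mixture_measure E K) A = (\<integral>t. measure (K t) {z. (t, z) \<in> A} \<partial>E)"
proof -
  have "Measurable.pred E (\<lambda>t. (t, z) \<in> A)" for z
    using A by measurable
  then have [measurable]: "(\<lambda>t. emeasure (K t) {z. (t, z) \<in> A}) \<in> borel_measurable E"
    by (rule borel_measurable_emeasure_section)
  have "(\<lambda>t. measure (K t) {z. (t, z) \<in> A}) \<in> borel_measurable E"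
    unfolding measure_def by measurable
  then show ?thesis
    unfolding measure_def[of "mixture_measure E K"] emeasure_mixture_measure[OF A]
    by (subst integral_eq_nn_integral) (auto simp: measure_pmf.emeasure_eq_measure)
qed

lemma distr_fst_mixture_measure: "distr (mixture_measure E K) E fst = E"
proof (rule measure_eqI)
  fix A assume "A \<in> sets (distr (mixture_measure E K) E fst)"
  then have A: "A \<in> events" by simp
  have sec: "emeasure (K t) {z. (t, z) \<in> A \<times> UNIV} = indicator A t" for t
    using measure_pmf.emeasure_space_1[of "K t"] by (auto simp: indicator_def)
  then have "emeasure (distr (mixture_measure E K) E fst) A =
      emeasure (mixture_measure E K) (A \<times> UNIV)"
    using A sets.sets_into_space[OF A]
    by (subst emeasure_distr) (auto intro!: arg_cong[where f = "emeasure _"])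
  also have "\<dots> = (\<integral>\<^sup>+t. indicator A t \<partial>E)"
    using A by (subst emeasure_mixture_measure) (simp_all add: sec del: mem_Sigma_iff)
  finally show "emeasure (distr (mixture_measure E K) E fst) A = emeasure E A"
    using A by simp
qed simp

text \<open>Every event of the sigma-algebra generated by \<open>fst\<close> is the preimage of some
  \<open>A'\<close>. Over it both integrals equal the integral of \<open>measure (K t) B\<close>
  over \<open>A'\<close>, once by the formula for the mixture and once because the first marginal is
  \<open>E\<close>.\<close>

lemma real_cond_exp_mixture_measure:
  "AE w in mixture_measure E K.
    real_cond_exp (mixture_measure E K) (vimage_algebra (space (mixture_measure E K)) fst E)
      (indicator {w \<in> space (mixture_measure E K). snd w \<in> B}) w = measure (K (fst w)) B"
proof -
  let ?M = "mixture_measure E K"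
  let ?F = "vimage_algebra (space ?M) fst E"
  interpret M: prob_space ?M by (rule prob_space_mixture_measure)
  have fst [measurable]: "fst \<in> measurable ?M E"
    by simp
  have "subalgebra ?M ?F"
    unfolding subalgebra_def using sets_vimage_algebra2[of fst "space ?M" E] measurable_sets[OF fst]
    by (auto simp: Pi_iff)
  then interpret finite_measure_subalgebra ?M ?F
    by unfold_locales
  have "(\<lambda>t. measure (K t) {z. z \<in> B}) \<in> borel_measurable E"
    unfolding measure_def by measurable
  then have meas [measurable]: "(\<lambda>t. measure (K t) B) \<in> borel_measurable E"
    by simp
  have [measurable]: "{w \<in> space ?M. snd w \<in> B} \<in> sets ?M"
    by measurable
  show ?thesis
  proof (rule real_cond_exp_charact)
    fix A assume "A \<in> sets ?F"
    then obtain A' where A': "A' \<in> sets E" and A: "A = fst -` A' \<inter> space ?M"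
      using sets_vimage_algebra2[of fst "space ?M" E] by (auto simp: Pi_iff)
    note [measurable] = A'
    have A_sets [measurable]: "A \<in> sets ?M"
      unfolding A by measurable
    have "(\<integral>w\<in>A. indicator {w \<in> space ?M. snd w \<in> B} w \<partial>?M) = measure ?M (A \<inter> {w \<in> space ?M. snd w \<in> B})"
      by (auto simp: set_lebesgue_integral_def simp flip: indicator_inter_arith intro!: arg_cong[where f = "measure ?M"])
    also have "\<dots> = (\<integral>t. measure (K t) {z. (t, z) \<in> A \<inter> {w \<in> space ?M. snd w \<in> B}} \<partial>E)"
      by (rule measure_mixture_measure) (use A_sets in \<open>simp flip: sets_mixture_measure\<close>)
    also have "\<dots> = (\<integral>t. indicator A' t * measure (K t) B \<partial>E)"
      by (intro Bochner_Integration.integral_cong) (auto simp: A indicator_def)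
    also have "\<dots> = (\<integral>t. indicator A' t * measure (K t) B \<partial>distr ?M E fst)"
      by (simp add: distr_fst_mixture_measure)
    also have "\<dots> = (\<integral>w\<in>A. measure (K (fst w)) B \<partial>?M)"
      unfolding set_lebesgue_integral_def
      by (subst integral_distr) (auto intro!: Bochner_Integration.integral_cong simp: A indicator_def)
    finally show "(\<integral>w\<in>A. indicator {w \<in> space ?M. snd w \<in> B} w \<partial>?M) = (\<integral>w\<in>A. measure (K (fst w)) B \<partial>?M)" .
  next
    show "integrable ?M (\<lambda>w. measure (K (fst w)) B)"
      by (rule M.integrable_const_bound[where B = 1]) auto
    show "(\<lambda>w. measure (K (fst w)) B) \<in> borel_measurable ?F"
      by (rule measurable_compose[OF measurable_vimage_algebra1 meas]) auto
  qed (simp add: M.emeasure_eq_measure)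
qed

end

lemma measure_pair_pmf_times:
  "measure (pair_pmf p q) {z. fst z \<in> A \<and> snd z \<in> B} = measure p A * measure q B"
proof -
  have "emeasure (pair_pmf p q) {z. fst z \<in> A \<and> snd z \<in> B} =
      (\<integral>\<^sup>+a. \<integral>\<^sup>+b. indicator A a * indicator B b \<partial>q \<partial>p)"
    by (simp add: nn_integral_pair_pmf' indicator_def flip: nn_integral_indicator)
      (auto intro!: nn_integral_cong)
  also have "\<dots> = emeasure p A * emeasure q B"
    by (simp add: nn_integral_cmult nn_integral_multc)
  finally show ?thesis
    by (simp add: measure_pmf.emeasure_eq_measure flip: ennreal_mult)
qed

text \<open>On a countable type the null singletons have a null union, so almost every point has
  positive mass, as the type of pmfs demands.\<close>

lemma measure_pmf_of_countable_distr:
  fixes f :: "'a \<Rightarrow> 'b::countable"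
  assumes "prob_space M" and f: "f \<in> measurable M (count_space UNIV)"
  shows "\<exists>p. measure_pmf p = distr M (count_space UNIV) f"
proof -
  interpret N: prob_space "distr M (count_space UNIV) f"
    using assms by (rule prob_space.prob_space_distr)
  have "AE x in distr M (count_space UNIV) f. \<forall>y. N.prob {y} = 0 \<longrightarrow> x \<noteq> y"
    unfolding AE_all_countable
  proof
    fix y
    show "AE x in distr M (count_space UNIV) f. N.prob {y} = 0 \<longrightarrow> x \<noteq> y"
      by (cases "N.prob {y} = 0") (auto simp: N.emeasure_eq_measure intro!: AE_I'[of "{y}"])
  qed
  then have "AE x in distr M (count_space UNIV) f. N.prob {x} \<noteq> 0"
    by eventually_elim auto
  then show ?thesis
    by (intro exI[of _ "Abs_pmf (distr M (count_space UNIV) f)"] Abs_pmf_inverse)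
      (auto intro: N.prob_space_axioms)
qed

section \<open>The limiting pair\<close>

context attachment_parameters
begin

definition offspring_law :: "real \<Rightarrow> (nat \<times> nat \<times> nat \<times> nat) pmf" where
  "offspring_law t =
     pair_pmf (nb_pmf \<delta>_in (exp (- c_in * t))) (pair_pmf (nb_pmf (1 + \<delta>_out) (exp (- c_out * t)))
       (pair_pmf (nb_pmf (1 + \<delta>_in) (exp (- c_in * t))) (nb_pmf \<delta>_out (exp (- c_out * t)))))"

definition joint_law :: "real \<Rightarrow> (nat \<times> nat \<times> nat \<times> nat \<times> nat) pmf" where
  "joint_law t = pair_pmf (binomial_pmf 1 \<gamma>) (offspring_law t)"

text \<open>The truncated subtraction \<open>1 - J\<close> is harmless, because \<open>J\<close> is
  0 or 1 under \<open>binomial_pmf 1 \<gamma>\<close>.\<close>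

definition degree_pair :: "nat \<times> nat \<times> nat \<times> nat \<times> nat \<Rightarrow> nat \<times> nat" where
  "degree_pair = (\<lambda>(J, X1, Y1, X2, Y2). ((1 - J) * X1 + J * (1 + X2), (1 - J) * (1 + Y1) + J * Y2))"

text \<open>For \<open>t \<le> 0\<close> the parameter is at least 1 and the default value of
  \<open>nb_pmf\<close> applies, so the function is \<open>birth_prob\<close> on one half-line and
  constant on the other.\<close>

lemma borel_measurable_pmf_nb_pmf:
  assumes "a > 0" "c > 0"
  shows "(\<lambda>t. pmf (nb_pmf a (exp (- c * t))) k) \<in> borel_measurable borel"
proof -
  have "pmf (nb_pmf a (exp (- c * t))) k = (if t > 0 then birth_prob a c k t else pmf (return_pmf 0) k)" for t
  proof (cases "t > 0")
    case True
    then show ?thesis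
      using pmf_nb_pmf_exp[OF assms] by simp
  next
    case False
    then have "exp (- c * t) \<ge> 1"
      using assms by (simp add: mult_nonneg_nonpos)
    then show ?thesis
      using False by (simp add: nb_pmf_def)
  qed
  then have "(\<lambda>t. pmf (nb_pmf a (exp (- c * t))) k) = (\<lambda>t. if t > 0 then birth_prob a c k t else pmf (return_pmf 0) k)"
    by blast
  also have "\<dots> \<in> borel_measurable borel"
    unfolding birth_prob_def by measurable
  finally show ?thesis .
qed

lemma gamma_bounds: "\<gamma> \<in> {0..1}" "\<gamma> > 0" "\<gamma> < 1"
  using gamma alpha by auto

lemma mixture_kernel_joint_law: "mixture_kernel exp_law joint_law"
proof -
  interpret prob_space exp_law by (rule prob_space_exp_law)
  show ?thesis
  proof
    fix z :: "nat \<times> nat \<times> nat \<times> nat \<times> nat"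
    obtain j k l k' l' where z: "z = (j, k, l, k', l')" by (cases z)
    have "(\<lambda>t. pmf (nb_pmf a (exp (- c * t))) k) \<in> borel_measurable exp_law" if "a > 0" "c > 0" for a c k
      using borel_measurable_pmf_nb_pmf[OF that] by (simp add: measurable_cong_sets[OF sets_exp_law refl])
    from this[of _ c_in] this[of _ c_out]
    show "(\<lambda>t. pmf (joint_law t) z) \<in> borel_measurable exp_law"
      unfolding z joint_law_def offspring_law_def pmf_pair
      by (intro borel_measurable_times borel_measurable_const) (use delta c_pos in auto)
  qed
qed

lemma measure_offspring_law_times:
  "measure (offspring_law t) {(x1, y1, x2, y2). x1 \<in> A \<and> y1 \<in> B \<and> x2 \<in> C \<and> y2 \<in> D} =
    measure (nb_pmf \<delta>_in (exp (- c_in * t))) A * measure (nb_pmf (1 + \<delta>_out) (exp (- c_out * t))) B *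
    measure (nb_pmf (1 + \<delta>_in) (exp (- c_in * t))) C * measure (nb_pmf \<delta>_out (exp (- c_out * t))) D"
proof -
  have "{(x1, y1, x2, y2). x1 \<in> A \<and> y1 \<in> B \<and> x2 \<in> C \<and> y2 \<in> D} =
      {z. fst z \<in> A \<and> snd z \<in> {z. fst z \<in> B \<and> snd z \<in> {z. fst z \<in> C \<and> snd z \<in> D}}}"
    by auto
  then show ?thesis
    unfolding offspring_law_def by (simp only: measure_pair_pmf_times mult.assoc)
qed

text \<open>The value of \<open>J\<close> decides which pair is seen; the coordinates of the other
  pair are unconstrained and contribute a factor 1.\<close>

lemma measure_joint_law_degree_pair:
  assumes "t > 0"
  shows "measure (joint_law t) {z. degree_pair z = (i, j)} = degree_prob i j t"
proof -
  define A where "A = {(x1 :: nat, y1, x2 :: nat, y2 :: nat). x1 \<in> {i} \<and> y1 \<in> {y. Suc y = j} \<and> x2 \<in> UNIV \<and> y2 \<in> UNIV}"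
  define B where "B = {(x1 :: nat, y1 :: nat, x2, y2). x1 \<in> UNIV \<and> y1 \<in> UNIV \<and> x2 \<in> {x. Suc x = i} \<and> y2 \<in> {j}}"
  \<comment> \<open>One plus a negative binomial variable with first parameter \<open>1 + a\<close>
    follows the birth process started in 1.\<close>
  have shift: "measure (nb_pmf (1 + a) (exp (- c * t))) {y. Suc y = k} = birth_prob_from_1 a c k t"
    if "a > 0" "c > 0" for a c k
  proof (cases k)
    case (Suc m)
    then have "{y. Suc y = k} = {m}" by auto
    then show ?thesis
      using that assms by (simp add: Suc birth_prob_from_1_def measure_pmf_single pmf_nb_pmf_exp[simplified])
  qed (simp add: birth_prob_from_1_def)
  have "measure (joint_law t) {z. degree_pair z = (i, j)} =
      measure (joint_law t) ({z. fst z \<in> {0} \<and> snd z \<in> A} \<union> {z. fst z \<in> {1} \<and> snd z \<in> B})"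
  proof (rule measure_pmf.finite_measure_eq_AE)
    have "set_pmf (joint_law t) \<subseteq> {0, 1} \<times> UNIV"
      using gamma_bounds by (auto simp: joint_law_def set_pmf_binomial_eq)
    then show "AE z in joint_law t. z \<in> {z. degree_pair z = (i, j)} \<longleftrightarrow>
        z \<in> {z. fst z \<in> {0} \<and> snd z \<in> A} \<union> {z. fst z \<in> {1} \<and> snd z \<in> B}"
      by (intro AE_pmfI) (auto simp: degree_pair_def A_def B_def)
  qed auto
  also have "\<dots> = measure (joint_law t) {z. fst z \<in> {0} \<and> snd z \<in> A} + measure (joint_law t) {z. fst z \<in> {1} \<and> snd z \<in> B}"
    by (intro measure_pmf.finite_measure_Union) auto
  also have "\<dots> = \<alpha> * measure (offspring_law t) A + \<gamma> * measure (offspring_law t) B"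
    unfolding joint_law_def measure_pair_pmf_times using gamma_bounds by (simp add: measure_pmf_single gamma)
  also have "\<dots> = degree_prob i j t"
    unfolding A_def B_def measure_offspring_law_times using shift[OF delta(1) c_pos(1)] shift[OF delta(2) c_pos(2)]
    by (simp add: degree_prob_def measure_pmf_single pmf_nb_pmf_exp[simplified] delta c_pos assms)
  finally show ?thesis .
qed

abbreviation "limit_space \<equiv> mixture_measure exp_law joint_law"

lemma limit_prob_conv_measure:
  "measure (distr limit_space (count_space UNIV) (\<lambda>w. degree_pair (snd w))) {(i, j)} = limit_prob i j"
proof -
  interpret mixture_kernel exp_law joint_law by (rule mixture_kernel_joint_law)
  let ?A = "{w \<in> space limit_space. degree_pair (snd w) = (i, j)}"
  have [measurable]: "(\<lambda>w. degree_pair (snd w)) \<in> measurable limit_space (count_space UNIV)"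
    by (rule measurable_compose[of snd _ "count_space UNIV"]) simp_all
  have A: "?A \<in> sets (exp_law \<Otimes>\<^sub>M count_space UNIV)"
    unfolding sets_mixture_measure[symmetric] by measurable
  have "measure (distr limit_space (count_space UNIV) (\<lambda>w. degree_pair (snd w))) {(i, j)} = measure limit_space ?A"
    by (subst measure_distr) (auto intro!: arg_cong[where f = "measure _"])
  also have "\<dots> = (\<integral>t. measure (joint_law t) {z. (t, z) \<in> ?A} \<partial>exp_law)"
    using A by (rule measure_mixture_measure)
  also have "\<dots> = (\<integral>t. degree_prob i j t \<partial>exp_law)"
  proof (rule integral_cong_AE)
    show "(\<lambda>t. measure (joint_law t) {z. (t, z) \<in> ?A}) \<in> borel_measurable exp_law"
      unfolding measure_def by simp
    show "AE t in exp_law. measure (joint_law t) {z. (t, z) \<in> ?A} = degree_prob i j t"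
      using AE_exp_law_pos by eventually_elim (simp add: measure_joint_law_degree_pair)
  qed simp
  finally show ?thesis
    by (simp add: limit_prob_def)
qed

text \<open>An outcome is \<open>(t, (J, X1, Y1, X2, Y2))\<close> and all variables are coordinate
  projections, so the conditional law given \<open>T\<close> is read off from the kernel.\<close>

lemma mixture_representation_limit_space:
  "mixture_representation limit_space \<gamma> \<delta>_in \<delta>_out c_in c_out
     (nb_pmf \<delta>_in) (nb_pmf (1 + \<delta>_out)) (nb_pmf (1 + \<delta>_in)) (nb_pmf \<delta>_out)
     (\<lambda>w. fst (snd w)) fst (\<lambda>w. fst (snd (snd w))) (\<lambda>w. fst (snd (snd (snd w))))
     (\<lambda>w. fst (snd (snd (snd (snd w))))) (\<lambda>w. snd (snd (snd (snd (snd w)))))"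
proof -
  interpret K: mixture_kernel exp_law joint_law by (rule mixture_kernel_joint_law)
  interpret prob_space limit_space by (rule K.prob_space_mixture_measure)
  have meas [measurable]: "(\<lambda>w. f (snd w)) \<in> measurable limit_space (count_space UNIV)" for f :: "_ \<Rightarrow> 'c"
    by (rule measurable_compose[of snd _ "count_space UNIV"]) simp_all
  have fst_meas [measurable]: "fst \<in> measurable limit_space borel"
    using measurable_fst[of exp_law "count_space UNIV"] by (simp cong: measurable_cong_sets)
  have prob_J: "prob {w \<in> space limit_space. fst (snd w) \<in> a} = measure (binomial_pmf 1 \<gamma>) a" for a
  proof -
    have "{w \<in> space limit_space. fst (snd w) \<in> a} \<in> sets (exp_law \<Otimes>\<^sub>M count_space UNIV)"
      unfolding K.sets_mixture_measure[symmetric] by measurable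
    from K.measure_mixture_measure[OF this] show ?thesis
      using measure_pair_pmf_times[of "binomial_pmf 1 \<gamma>" "offspring_law _" a UNIV] K.prob_space
      by (simp add: joint_law_def)
  qed
  show ?thesis
  proof
    show "is_neg_binomial \<delta>_in p (nb_pmf \<delta>_in p)" "is_neg_binomial (1 + \<delta>_out) p (nb_pmf (1 + \<delta>_out) p)"
      "is_neg_binomial (1 + \<delta>_in) p (nb_pmf (1 + \<delta>_in) p)" "is_neg_binomial \<delta>_out p (nb_pmf \<delta>_out p)"
      if "0 < p" "p < 1" for p
      using that delta by (auto intro!: is_neg_binomial_nb_pmf)
    show "random_variable (count_space UNIV) (\<lambda>w. fst (snd w))"
      "random_variable (count_space UNIV) (\<lambda>w. fst (snd (snd w)))"
      "random_variable (count_space UNIV) (\<lambda>w. fst (snd (snd (snd w))))"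
      "random_variable (count_space UNIV) (\<lambda>w. fst (snd (snd (snd (snd w)))))"
      "random_variable (count_space UNIV) (\<lambda>w. snd (snd (snd (snd (snd w)))))"
      by (rule meas)+
    show "\<P>(w in limit_space. fst (snd w) = 1) = \<gamma>" "\<P>(w in limit_space. fst (snd w) = 0) = 1 - \<gamma>"
      using prob_J[of "{1}"] prob_J[of "{0}"] gamma_bounds by (simp_all add: measure_pmf_single)
    have "distr limit_space lborel fst = distr limit_space exp_law fst"
      by (intro distr_cong) auto
    then show "distributed limit_space lborel fst (exponential_density 1)"
      unfolding distributed_def by (simp add: K.distr_fst_mixture_measure) (simp add: exp_law_def)
  next
    fix k l k' l' :: nat
    \<comment> \<open>\<open>exp_law\<close> has the sets of \<open>borel\<close>, so both generate
      the same sigma-algebra through \<open>fst\<close>.\<close>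
    have F: "vimage_algebra (space limit_space) fst borel = vimage_algebra (space limit_space) fst exp_law"
      by (rule vimage_algebra_cong) auto
    have "measure (joint_law t) {z. snd z = (k, l, k', l')} =
        pmf (nb_pmf \<delta>_in (exp (- c_in * t))) k * pmf (nb_pmf (1 + \<delta>_out) (exp (- c_out * t))) l *
        pmf (nb_pmf (1 + \<delta>_in) (exp (- c_in * t))) k' * pmf (nb_pmf \<delta>_out (exp (- c_out * t))) l'" for t
      using measure_pair_pmf_times[of "binomial_pmf 1 \<gamma>" "offspring_law t" UNIV "{(k, l, k', l')}"]
      by (simp add: joint_law_def measure_pmf_single offspring_law_def pmf_pair)
    moreover have "{w \<in> space limit_space. snd w \<in> {z. snd z = (k, l, k', l')}} =
        {w \<in> space limit_space. fst (snd (snd w)) = k \<and> fst (snd (snd (snd w))) = l \<and>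
          fst (snd (snd (snd (snd w)))) = k' \<and> snd (snd (snd (snd (snd w)))) = l'}"
      by auto
    ultimately show "AE w in limit_space. real_cond_exp limit_space (vimage_algebra (space limit_space) fst borel)
        (indicator {w \<in> space limit_space. fst (snd (snd w)) = k \<and> fst (snd (snd (snd w))) = l \<and>
          fst (snd (snd (snd (snd w)))) = k' \<and> snd (snd (snd (snd (snd w)))) = l'}) w =
        pmf (nb_pmf \<delta>_in (exp (- c_in * fst w))) k * pmf (nb_pmf (1 + \<delta>_out) (exp (- c_out * fst w))) l *
        pmf (nb_pmf (1 + \<delta>_in) (exp (- c_in * fst w))) k' * pmf (nb_pmf \<delta>_out (exp (- c_out * fst w))) l'"
      unfolding F using K.real_cond_exp_mixture_measure[of "{z. snd z = (k, l, k', l')}"] by simp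
  next
    let ?J = "\<lambda>w. fst (snd w) :: nat"
    let ?V = "\<lambda>w. (fst w, (fst (snd (snd w)), fst (snd (snd (snd w))), fst (snd (snd (snd (snd w)))), snd (snd (snd (snd (snd w))))))
       :: real \<times> nat \<times> nat \<times> nat \<times> nat"
    have V [measurable]: "?V \<in> measurable limit_space (borel \<Otimes>\<^sub>M count_space UNIV)"
      by (intro measurable_Pair fst_meas meas)
    have J: "?J \<in> measurable limit_space (count_space UNIV)"
      by (rule meas)
    show "indep_set (sets (vimage_algebra (space limit_space) ?J (count_space UNIV)))
      (sets (vimage_algebra (space limit_space) ?V (borel \<Otimes>\<^sub>M count_space UNIV)))"
    proof (rule indep_setI)
      show "sets (vimage_algebra (space limit_space) ?J (count_space UNIV)) \<subseteq> events"
        using measurable_sets[OF J] by (subst sets_vimage_algebra2) auto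
      show "sets (vimage_algebra (space limit_space) ?V (borel \<Otimes>\<^sub>M count_space UNIV)) \<subseteq> events"
        using measurable_sets[OF V] by (subst sets_vimage_algebra2) (auto simp: space_pair_measure)
    next
      fix A B
      assume "A \<in> sets (vimage_algebra (space limit_space) ?J (count_space UNIV))"
      then obtain a where A: "A = ?J -` a \<inter> space limit_space"
        by (subst (asm) sets_vimage_algebra2) auto
      assume "B \<in> sets (vimage_algebra (space limit_space) ?V (borel \<Otimes>\<^sub>M count_space UNIV))"
      then obtain b where b [measurable]: "b \<in> sets (borel \<Otimes>\<^sub>M count_space UNIV)" and B: "B = ?V -` b \<inter> space limit_space"
        by (subst (asm) sets_vimage_algebra2) (auto simp: space_pair_measure)
      have A_sets: "A \<in> events" and B_sets: "B \<in> events"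
        unfolding A B using measurable_sets[OF J] measurable_sets[OF V] by auto
      have "prob (A \<inter> B) = (\<integral>t. measure (joint_law t) {z. fst z \<in> a \<and> snd z \<in> {y. (t, y) \<in> b}} \<partial>exp_law)"
        using K.measure_mixture_measure[of "A \<inter> B"] sets.Int[OF A_sets B_sets] by (simp add: A B)
      \<comment> \<open>The law of \<open>J\<close> inside \<open>joint_law t\<close> does not
        depend on \<open>t\<close>. Its factor leaves the integral, and this yields the independence
        of \<open>J\<close>.\<close>
      also have "\<dots> = measure (binomial_pmf 1 \<gamma>) a * (\<integral>t. measure (offspring_law t) {y. (t, y) \<in> b} \<partial>exp_law)"
        by (simp only: joint_law_def measure_pair_pmf_times integral_mult_right_zero)
      also have "(\<integral>t. measure (offspring_law t) {y. (t, y) \<in> b} \<partial>exp_law) =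
          (\<integral>t. measure (joint_law t) {z. fst z \<in> UNIV \<and> snd z \<in> {y. (t, y) \<in> b}} \<partial>exp_law)"
        by (simp only: joint_law_def measure_pair_pmf_times measure_pmf.prob_space[simplified] mult_1) simp
      also have "\<dots> = prob B"
        using K.measure_mixture_measure[of B] B_sets by (simp add: B)
      also have "measure (binomial_pmf 1 \<gamma>) a = prob A"
        using prob_J[of a] unfolding A by (simp add: vimage_def Int_def conj_commute)
      finally show "prob (A \<inter> B) = prob A * prob B" .
    qed
  qed
qed

end

theorem theorem5p1:
  fixes \<alpha> \<gamma> \<delta>_in \<delta>_out c_in c_out :: real
    and M :: "'w measure" and G :: "nat \<Rightarrow> 'w \<Rightarrow> nat pair_pre_digraph"
  assumes "0 < \<alpha>" "\<alpha> < 1" and "\<gamma> = 1 - \<alpha>" and "\<delta>_in > 0" "\<delta>_out > 0"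
    and "c_in = \<alpha> / (1 + \<delta>_in)" and "c_out = \<gamma> / (1 + \<delta>_out)"
    and "preferential_attachment M \<alpha> \<gamma> \<delta>_in \<delta>_out G"
  shows "\<exists>IO :: (nat \<times> nat) pmf.
    (\<forall>i j. tendsto_in_prob M (\<lambda>n \<omega>. real (node_count i j (G n \<omega>)) / real n) (pmf IO (i, j))) \<and>
    (\<exists>(\<Omega> :: (real \<times> nat \<times> nat \<times> nat \<times> nat \<times> nat) measure) B1 C1 B2 C2 J T X1 Y1 X2 Y2.
       mixture_representation \<Omega> \<gamma> \<delta>_in \<delta>_out c_in c_out B1 C1 B2 C2 J T X1 Y1 X2 Y2 \<and>
       measure_pmf IO = distr \<Omega> (count_space UNIV)
         (\<lambda>\<omega>. ((1 - J \<omega>) * X1 \<omega> + J \<omega> * (1 + X2 \<omega>),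
               (1 - J \<omega>) * (1 + Y1 \<omega>) + J \<omega> * Y2 \<omega>)))"
proof -
  interpret attachment_parameters \<alpha> \<gamma> \<delta>_in \<delta>_out
    using assms by unfold_locales
  interpret L: attachment_model_limit M \<alpha> \<gamma> \<delta>_in \<delta>_out G limit_prob
    using assms(8) limiting_frequencies_limit_prob attachment_parameters_axioms
    by (intro attachment_model_limit.intro attachment_model.intro)
  \<comment> \<open>The variables \<open>c_in\<close> and \<open>c_out\<close> of the theorem hide
    the locale constants of the same names, so the two are identified explicitly.\<close>
  have c: "attachment_parameters.c_in \<alpha> \<delta>_in = c_in" "attachment_parameters.c_out \<gamma> \<delta>_out = c_out"
    by (simp_all only: c_in_def c_out_def assms(6,7))
  note rep = mixture_representation_limit_space[unfolded c]
  interpret R: mixture_representation limit_space \<gamma> \<delta>_in \<delta>_out c_in c_out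
     "nb_pmf \<delta>_in" "nb_pmf (1 + \<delta>_out)" "nb_pmf (1 + \<delta>_in)" "nb_pmf \<delta>_out"
     "\<lambda>w. fst (snd w)" fst "\<lambda>w. fst (snd (snd w))" "\<lambda>w. fst (snd (snd (snd w)))"
     "\<lambda>w. fst (snd (snd (snd (snd w))))" "\<lambda>w. snd (snd (snd (snd (snd w))))"
    by (rule rep)
  have "(\<lambda>w. degree_pair (snd w)) \<in> measurable limit_space (count_space UNIV)"
    by (rule measurable_compose[of snd _ "count_space UNIV"]) (simp_all add: mixture_measure_def)
  from measure_pmf_of_countable_distr[OF R.prob_space_axioms this]
  obtain IO where IO: "measure_pmf IO = distr limit_space (count_space UNIV) (\<lambda>w. degree_pair (snd w))"
    by auto
  have "pmf IO (i, j) = limit_prob i j" for i j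
    using limit_prob_conv_measure[of i j] by (simp add: IO flip: measure_pmf_single)
  then have "\<forall>i j. tendsto_in_prob M (\<lambda>n \<omega>. real (node_count i j (G n \<omega>)) / real n) (pmf IO (i, j))"
    using L.node_count_tendsto_in_prob by simp
  moreover have "measure_pmf IO = distr limit_space (count_space UNIV)
      (\<lambda>w. ((1 - fst (snd w)) * fst (snd (snd w)) + fst (snd w) * (1 + fst (snd (snd (snd (snd w))))),
            (1 - fst (snd w)) * (1 + fst (snd (snd (snd w)))) + fst (snd w) * snd (snd (snd (snd (snd w))))))"
    unfolding IO degree_pair_def by (simp add: split_beta)
  ultimately show ?thesis
    using rep by blast
qed

end
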